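(* Let $(X_k)_{k\ge 1}$ be a sequence of independent real-valued random variables with $\mathbb{E}X_k=0$ and finite variances $\sigma_k^2=\mathbb{E}X_k^2\in(0,\infty)$. Assume that, for every $k\ge 1$, the law of $X_k$ has an absolutely continuous density $p_k$ satisfying $J(X_k)<\infty$, and assume additionally that $\sup_{k\ge 1}J(X_k)<\infty$. Put $b_n=\sqrt{\sigma_1^2+\cdots+\sigma_n^2}$ and $S_n=\frac{X_1+\cdots+X_n}{b_n}$ for $n\ge1$, and let $N$ be a standard normal random variable. Then the following two statements are equivalent: (i) Lindeberg's condition is satisfied: for all $\varepsilon>0$, $$\lim_{n\to\infty}\frac{1}{b_n^2}\sum_{k=1}^n\mathbb{E}\big[X_k^2\,\mathbf{1}_{\{|X_k|>\varepsilon b_n\}}\big]=0.$$ (ii) $d_{TV}(S_n,N)\to 0$ as $n\to\infty$ and the Feller-Lévy condition is satisfied: $\max_{1\le k\le n}(\sigma_k^2/b_n^2)\to 0$ as $n\to\infty$.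
   Context: $\mathbf{1}_A$ denotes the indicator function of the event $A$. For real random variables $U,V$, the total variation distance between their laws is $d_{TV}(U,V)=\frac12\sup_{\|h\|_\infty\le 1}|\mathbb{E}h(U)-\mathbb{E}h(V)|$, where the supremum is over measurable $h:\mathbb{R}\to\mathbb{R}$ with $\|h\|_\infty:=\sup_{x\in\mathbb{R}}|h(x)|\le 1$. For a random variable $X$ with finite variance and an absolutely continuous density $p$ (with Radon-Nikodym derivative $p'$), the score function is $\rho=p'/p$ (on $\{p>0\}$), the standardised Fisher information is $$J_{st}(X)=\mathrm{Var}(X)\int_{-\infty}^{+\infty}\frac{p'(x)^2}{p(x)}\,dx-1=\mathrm{Var}(X)\,\mathbb{E}[\rho^2(X)]-1$$ (the integral being taken over $\{p>0\}$), and $J(X):=J_{st}(X)+1=\mathrm{Var}(X)\,\mathbb{E}[\rho^2(X)]$. *)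

theory Defs
  imports "HOL-Probability.Probability"
begin

text \<open>The supremum is a conditionally complete one over reals; for probability spaces and
  measurable \<open>U\<close>, \<open>V\<close> the set is nonempty and bounded by 2. The two variables
  may live on different spaces.\<close>

definition d_TV :: "'a measure \<Rightarrow> ('a \<Rightarrow> real) \<Rightarrow> 'b measure \<Rightarrow> ('b \<Rightarrow> real) \<Rightarrow> real" where
  "d_TV M U M' V =
     1 / 2 * (SUP h \<in> {h :: real \<Rightarrow> real. h \<in> borel_measurable borel \<and> (\<forall>x. \<bar>h x\<bar> \<le> 1)}.
                \<bar>prob_space.expectation M (\<lambda>\<omega>. h (U \<omega>)) - prob_space.expectation M' (\<lambda>\<omega>. h (V \<omega>))\<bar>)"

definition abs_continuous_on_Icc :: "real \<Rightarrow> real \<Rightarrow> (real \<Rightarrow> real) \<Rightarrow> bool" where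
  "abs_continuous_on_Icc a b f \<longleftrightarrow>
     (\<forall>\<epsilon>>0. \<exists>\<delta>>0. \<forall>(n :: nat) (u :: nat \<Rightarrow> real) (v :: nat \<Rightarrow> real).
        (\<forall>i<n. a \<le> u i \<and> u i \<le> v i \<and> v i \<le> b) \<and>
        (\<forall>i<n. \<forall>j<n. i \<noteq> j \<longrightarrow> {u i<..<v i} \<inter> {u j<..<v j} = {}) \<and>
        (\<Sum>i<n. v i - u i) < \<delta>
        \<longrightarrow> (\<Sum>i<n. \<bar>f (v i) - f (u i)\<bar>) < \<epsilon>)"

text \<open>\<open>f'\<close> is a density, with respect to Lebesgue measure, of the (locally finite signed) measure
  that gives \<open>{a<..b}\<close> the mass \<open>f b - f a\<close>. It is determined by \<open>f\<close> up to a null set.\<close>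

definition RN_derivative_of :: "(real \<Rightarrow> real) \<Rightarrow> (real \<Rightarrow> real) \<Rightarrow> bool" where
  "RN_derivative_of f f' \<longleftrightarrow> f' \<in> borel_measurable borel \<and>
     (\<forall>a b. a \<le> b \<longrightarrow>
        set_integrable lborel {a<..b} f' \<and> f b - f a = (LINT x:{a<..b}|lborel. f' x))"

text \<open>Absolute continuity on the whole line is required only locally; when the Fisher
  information is finite, the derivative is integrable and there is no difference.\<close>

definition has_abs_continuous_density ::
  "'a measure \<Rightarrow> ('a \<Rightarrow> real) \<Rightarrow> (real \<Rightarrow> real) \<Rightarrow> (real \<Rightarrow> real) \<Rightarrow> bool" where
  "has_abs_continuous_density M X p p' \<longleftrightarrow>
     (\<forall>x. 0 \<le> p x) \<and> distributed M lborel X (\<lambda>x. ennreal (p x)) \<and>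
     (\<forall>a b. abs_continuous_on_Icc a b p) \<and> RN_derivative_of p p'"

text \<open>\<open>J(X)\<close>, with values in \<open>[0, \<infinity>]\<close>, for a variable with density \<open>p\<close> and
  Radon-Nikodym derivative \<open>p'\<close> of \<open>p\<close>.\<close>

definition fisher_J ::
  "'a measure \<Rightarrow> ('a \<Rightarrow> real) \<Rightarrow> (real \<Rightarrow> real) \<Rightarrow> (real \<Rightarrow> real) \<Rightarrow> ennreal" where
  "fisher_J M X p p' =
     ennreal (prob_space.variance M X) * (\<integral>\<^sup>+x\<in>{x. p x > 0}. ennreal ((p' x)\<^sup>2 / p x) \<partial>lborel)"

lemma fisher_J_eq_score:
  assumes "has_abs_continuous_density M X p p'"
  shows "fisher_J M X p p' =
     ennreal (prob_space.variance M X) * (\<integral>\<^sup>+\<omega>. ennreal ((p' (X \<omega>) / p (X \<omega>))\<^sup>2) \<partial>M)"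
proof -
  have d: "distributed M lborel X (\<lambda>x. ennreal (p x))" and nn: "\<And>x. 0 \<le> p x"
    and m': "p' \<in> borel_measurable borel"
    using assms by (auto simp: has_abs_continuous_density_def RN_derivative_of_def)
  have "(\<lambda>x. enn2real (ennreal (p x))) \<in> borel_measurable lborel"
    using distributed_borel_measurable[OF d] by measurable
  then have m: "p \<in> borel_measurable borel"
    using nn by simp
  have "(\<integral>\<^sup>+\<omega>. ennreal ((p' (X \<omega>) / p (X \<omega>))\<^sup>2) \<partial>M)
      = (\<integral>\<^sup>+x. ennreal (p x) * ennreal ((p' x / p x)\<^sup>2) \<partial>lborel)"
    by (rule distributed_nn_integral[OF d, symmetric]) (use m m' in measurable)
  also have "\<dots> = (\<integral>\<^sup>+x\<in>{x. p x > 0}. ennreal ((p' x)\<^sup>2 / p x) \<partial>lborel)"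
  proof (rule nn_integral_cong)
    fix x
    show "ennreal (p x) * ennreal ((p' x / p x)\<^sup>2)
        = ennreal ((p' x)\<^sup>2 / p x) * indicator {x. p x > 0} x"
      using nn[of x]
      by (cases "p x = 0") (auto simp: ennreal_mult[symmetric] power2_eq_square)
  qed
  finally show ?thesis
    by (simp add: fisher_J_def)
qed

end

theory Submission
  imports Defs
begin

text \<open>
  One direction is Feller's: convergence in total variation gives convergence of the
  characteristic functions, and under the Feller-Levy condition this forces Lindeberg's condition.
  In the other direction Lindeberg's condition gives weak convergence, and the bound on the Fisher
  informations upgrades it to total variation.

  Both directions compare characteristic functions in the same way. If \<open>\<phi>\<^sub>k\<close> is the
  characteristic function of the \<open>k\<close>-th normalized summand at a fixed point, then \<open>\<Prod>\<phi>\<^sub>k\<close>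
  differs from \<open>exp (\<Sum>(\<phi>\<^sub>k - 1))\<close> by at most a multiple of \<open>\<Sum>\<bar>\<phi>\<^sub>k - 1\<bar>\<^sup>2\<close>, which the Feller-Levy
  condition makes small. Under Lindeberg's condition the exponent tends to \<open>- t\<^sup>2 / 2\<close>. Conversely,
  if the limit is normal, then the real part of the exponent tends to \<open>- t\<^sup>2 / 2\<close>, so the sum of the
  nonnegative quantities \<open>E (cos (t Y) - 1 + (t Y)\<^sup>2 / 2)\<close> over the normalized summands \<open>Y\<close> tends
  to 0; for one suitable \<open>t\<close> the integrand dominates \<open>Y\<^sup>2\<close> where \<open>\<bar>Y\<bar> > \<epsilon>\<close>
  (\<open>char_limit_feller_levy_imp_lindeberg\<close>).

  The upgrade rests on a translation inequality: for measurable \<open>h\<close> with \<open>\<bar>h\<bar> \<le> 1\<close>,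
  \<open>\<bar>E h (S\<^sub>n + t) - E h (S\<^sub>n)\<bar> \<le> sqrt C * \<bar>t\<bar>\<close>, where \<open>C\<close> bounds all the \<open>J (X\<^sub>k)\<close>. Let
  \<open>G\<close> be the bounded antiderivative \<open>u \<mapsto> \<integral>h\<close> over \<open>{u..<u + t}\<close> of \<open>h (u + t) - h u\<close>. Integrating by parts
  in the variable \<open>X\<^sub>k\<close> alone turns the difference of expectations into \<open>- E (G (S) * \<rho>\<^sub>k (X\<^sub>k))\<close>, with the
  score \<open>\<rho>\<^sub>k\<close> of \<open>X\<^sub>k\<close>, and this holds for every \<open>k\<close>. Averaging over \<open>k\<close> with weights
  \<open>\<sigma>\<^sub>k\<^sup>2 / b\<^sub>n\<^sup>2\<close> replaces the single score by a sum of independent centred variables, whose second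
  moment is at most \<open>C / b\<^sub>n\<^sup>2\<close> (\<open>translation_bound_indep_sum\<close>,
  \<open>normalized_sum_translation_bound\<close>). No density of a sum enters.

  Hence adding a small independent normal variable to \<open>S\<^sub>n\<close> or to the limit moves
  each law by little in total variation, uniformly in \<open>n\<close>. The smoothed laws have
  densities that converge pointwise by weak convergence, and so in \<open>L\<^sup>1\<close> by Scheffe's lemma
  (\<open>weak_conv_imp_uniform_conv_bounded_measurable\<close>).
\<close>

section \<open>Calculus of Radon-Nikodym derivatives\<close>

lemma RN_derivative_ofD:
  assumes "RN_derivative_of f f'"
  shows "f' \<in> borel_measurable borel"
    and "a \<le> b \<Longrightarrow> set_integrable lborel {a<..b} f'"
    and "a \<le> b \<Longrightarrow> f b - f a = (LINT x:{a<..b}|lborel. f' x)"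
  using assms by (auto simp: RN_derivative_of_def)

lemma abs_RN_increment_le:
  assumes "RN_derivative_of f f'" "a \<le> x" "x \<le> b"
  shows "\<bar>f x - f a\<bar> \<le> (LINT y:{a<..b}|lborel. \<bar>f' y\<bar>)"
proof -
  note D = RN_derivative_ofD[OF assms(1)]
  have "\<bar>f x - f a\<bar> = \<bar>LINT y|lborel. indicator {a<..x} y * f' y\<bar>"
    using D(3)[OF assms(2)] by (simp add: set_lebesgue_integral_def)
  also have "\<dots> \<le> (LINT y|lborel. indicator {a<..b} y * \<bar>f' y\<bar>)"
    using D(2)[of a x] D(2)[of a b] assms(2,3)
    by (intro integral_abs_bound_integral)
       (auto simp: set_integrable_def abs_mult split: split_indicator intro: integrable_abs[of _ "\<lambda>x. indicator {a<..b} x * f' x", simplified abs_mult abs_indicator])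
  finally show ?thesis by (simp add: set_lebesgue_integral_def)
qed

text \<open>The product of the increments of \<open>f\<close> and \<open>g\<close> over \<open>{a<..b}\<close> is the integral of
  \<open>f' x * g' y\<close> over a square. Its parts over the triangles \<open>y \<le> x\<close> and \<open>x < y\<close> are
  \<open>\<integral>f' x * (g x - g a)\<close> and, by Fubini, \<open>\<integral>g' y * (f y - f a)\<close>.\<close>
lemma RN_derivative_of_mult:
  fixes f g f' g' :: "real \<Rightarrow> real"
  assumes f: "RN_derivative_of f f'" and g: "RN_derivative_of g g'"
    and [measurable]: "f \<in> borel_measurable borel" "g \<in> borel_measurable borel"
  shows "RN_derivative_of (\<lambda>x. f x * g x) (\<lambda>x. f' x * g x + f x * g' x)"
  unfolding RN_derivative_of_def
proof (intro conjI allI impI)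
  note Df = RN_derivative_ofD[OF f] and Dg = RN_derivative_ofD[OF g]
  note [measurable] = Df(1) Dg(1)
  show "(\<lambda>x. f' x * g x + f x * g' x) \<in> borel_measurable borel" by measurable
  fix a b :: real assume ab: "a \<le> b"
  define F where "F x = indicator {a<..b} x * f' x" for x
  define G where "G x = indicator {a<..b} x * g' x" for x
  have [measurable]: "F \<in> borel_measurable borel" "G \<in> borel_measurable borel"
    unfolding F_def G_def by measurable
  have iF: "integrable lborel F" and iG: "integrable lborel G"
    using Df(2)[OF ab] Dg(2)[OF ab] by (simp_all add: set_integrable_def F_def[abs_def] G_def[abs_def])
  have bd: "integrable lborel (\<lambda>x. H x * (h x - h a))"
    if "integrable lborel H" "h \<in> borel_measurable borel" "RN_derivative_of h h'"
       "\<And>x. x \<notin> {a<..b} \<Longrightarrow> H x = 0" for H h h'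
  proof (rule Bochner_Integration.integrable_bound)
    show "integrable lborel (\<lambda>x. (LINT y:{a<..b}|lborel. \<bar>h' y\<bar>) * H x)"
      using that by auto
    show "(\<lambda>x. H x * (h x - h a)) \<in> borel_measurable lborel"
      using that(2) borel_measurable_integrable[OF that(1)] by measurable
    show "AE x in lborel. norm (H x * (h x - h a)) \<le> norm ((LINT y:{a<..b}|lborel. \<bar>h' y\<bar>) * H x)"
    proof (rule AE_I2)
      fix x
      show "norm (H x * (h x - h a)) \<le> norm ((LINT y:{a<..b}|lborel. \<bar>h' y\<bar>) * H x)"
      proof (cases "x \<in> {a<..b}")
        case True
        then show ?thesis
          using abs_RN_increment_le[OF that(3), of a x b]
          by (auto simp: abs_mult mult.commute[of "set_lebesgue_integral _ _ _"] intro!: mult_left_mono)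
      qed (simp add: that(4))
    qed
  qed
  have iFg: "integrable lborel (\<lambda>x. F x * (g x - g a))"
    and iGf: "integrable lborel (\<lambda>x. G x * (f x - f a))"
    by (rule bd[OF iF _ g], simp, simp add: F_def) (rule bd[OF iG _ f], simp, simp add: G_def)
  have eq: "indicat_real {a<..b} x * (f' x * g x + f x * g' x)
      = (F x * (g x - g a) + G x * (f x - f a)) + (F x * g a + G x * f a)" for x
    by (simp add: F_def G_def algebra_simps)
  show "set_integrable lborel {a<..b} (\<lambda>x. f' x * g x + f x * g' x)"
    unfolding set_integrable_def real_scaleR_def eq using iFg iGf iF iG by auto
  have IF: "(LINT x|lborel. F x) = f b - f a" and IG: "(LINT x|lborel. G x) = g b - g a"
    using Df(3)[OF ab] Dg(3)[OF ab] by (simp_all add: set_lebesgue_integral_def F_def G_def)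
  have iG1: "integrable lborel (\<lambda>y. G y * indicator {..x} y)"
    and iG2: "integrable lborel (\<lambda>y. G y * indicator {x<..} y)" for x
    by (intro integrable_real_mult_indicator iG, simp)+
  have in1: "F x * (LINT y|lborel. G y * indicator {..x} y) = F x * (g x - g a)" for x
  proof (cases "x \<in> {a<..b}")
    case True
    have "(LINT y|lborel. G y * indicator {..x} y) = (LINT y:{a<..x}|lborel. g' y)"
      unfolding set_lebesgue_integral_def
      by (intro Bochner_Integration.integral_cong) (use True in \<open>auto simp: G_def split: split_indicator\<close>)
    with True show ?thesis using Dg(3)[of a x] by simp
  qed (simp add: F_def)
  have in2: "G y * (LINT x|lborel. F x * indicator {y<..} y) = 0" for y by simp
  have in3: "G y * (LINT x|lborel. F x * indicator {..<y} x) = G y * (f y - f a)" for y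
  proof (cases "y \<in> {a<..b}")
    case True
    have "AE x in lborel. x \<noteq> y" by (rule AE_lborel_singleton)
    then have "(LINT x|lborel. F x * indicator {..<y} x) = (LINT x|lborel. indicator {a<..y} x *\<^sub>R f' x)"
      by (intro integral_cong_AE) (use True in \<open>auto simp: F_def split: split_indicator\<close>)
    with True show ?thesis using Df(3)[of a y] by (simp add: set_lebesgue_integral_def)
  qed (simp add: G_def)
  have "(\<lambda>(x, y). F x * (G y * indicator {x<..} y))
      = (\<lambda>z. F (fst z) * (G (snd z) * (if fst z < snd z then 1 else 0)))"
    by (auto simp: fun_eq_iff)
  also have "\<dots> \<in> borel_measurable (lborel \<Otimes>\<^sub>M lborel)" by measurable
  finally have pm: "(\<lambda>(x, y). F x * (G y * indicator {x<..} y)) \<in> borel_measurable (lborel \<Otimes>\<^sub>M lborel)" .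
  have pint: "integrable (lborel \<Otimes>\<^sub>M lborel) (\<lambda>(x, y). F x * (G y * indicator {x<..} y))"
  proof (rule lborel_pair.Fubini_integrable)
    show "integrable lborel (\<lambda>x. LINT y|lborel. norm (case (x, y) of (x, y) \<Rightarrow> F x * (G y * indicator {x<..} y)))"
    proof (rule Bochner_Integration.integrable_bound)
      show "integrable lborel (\<lambda>x. (LINT y|lborel. \<bar>G y\<bar>) * F x)" using iF by simp
      show "AE x in lborel. norm (LINT y|lborel. norm (case (x, y) of (x, y) \<Rightarrow> F x * (G y * indicator {x<..} y)))
         \<le> norm ((LINT y|lborel. \<bar>G y\<bar>) * F x)"
      proof (rule AE_I2)
        fix x
        have "(LINT y|lborel. norm (F x * (G y * indicator {x<..} y)))
            \<le> (LINT y|lborel. \<bar>F x\<bar> * \<bar>G y\<bar>)"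
          by (intro integral_mono integrable_norm integrable_mult_right iG2 integrable_abs iG)
             (auto simp: abs_mult split: split_indicator)
        then show "norm (LINT y|lborel. norm (case (x, y) of (x, y) \<Rightarrow> F x * (G y * indicator {x<..} y)))
         \<le> norm ((LINT y|lborel. \<bar>G y\<bar>) * F x)"
          by (simp add: abs_mult mult.commute integral_nonneg_AE abs_of_nonneg)
      qed
    qed (use pm in measurable)
  qed (use iG2 pm in auto)
  have "(f b - f a) * (g b - g a) = (LINT x|lborel. F x * (LINT y|lborel. G y))"
    by (simp add: IF IG)
  also have "\<dots> = (LINT x|lborel. F x * (LINT y|lborel. G y * indicator {..x} y)
                   + F x * (LINT y|lborel. G y * indicator {x<..} y))"
  proof (rule Bochner_Integration.integral_cong[OF refl])
    fix x :: real
    have "(LINT y|lborel. G y) = (LINT y|lborel. G y * indicator {..x} y + G y * indicator {x<..} y)"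
      by (intro Bochner_Integration.integral_cong) (auto split: split_indicator)
    also have "\<dots> = (LINT y|lborel. G y * indicator {..x} y) + (LINT y|lborel. G y * indicator {x<..} y)"
      by (intro Bochner_Integration.integral_add iG1 iG2)
    finally show "F x * (LINT y|lborel. G y) = F x * (LINT y|lborel. G y * indicator {..x} y)
                   + F x * (LINT y|lborel. G y * indicator {x<..} y)"
      by (simp add: distrib_left)
  qed
  also have "\<dots> = (LINT x|lborel. F x * (LINT y|lborel. G y * indicator {..x} y))
                + (LINT x|lborel. F x * (LINT y|lborel. G y * indicator {x<..} y))"
    using lborel_pair.integrable_fst'[OF pint]
    by (intro Bochner_Integration.integral_add) (simp_all add: in1 iFg)
  also have "(LINT x|lborel. F x * (LINT y|lborel. G y * indicator {x<..} y))
      = (LINT x|lborel. LINT y|lborel. F x * (G y * indicator {x<..} y))" by simp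
  also have "\<dots> = (LINT y|lborel. LINT x|lborel. F x * (G y * indicator {x<..} y))"
    using lborel_pair.Fubini_integral[OF pint] by simp
  also have "\<dots> = (LINT y|lborel. G y * (LINT x|lborel. F x * indicator {..<y} x))"
    unfolding integral_mult_right_zero[symmetric]
    by (intro Bochner_Integration.integral_cong refl) (auto split: split_indicator)
  finally have key: "(f b - f a) * (g b - g a) = (LINT x|lborel. F x * (g x - g a))
       + (LINT x|lborel. G x * (f x - f a))"
    by (simp add: in1 in3)
  have "(LINT x:{a<..b}|lborel. f' x * g x + f x * g' x)
      = (LINT x|lborel. F x * (g x - g a)) + (LINT x|lborel. G x * (f x - f a))
        + ((f b - f a) * g a + (g b - g a) * f a)"
    unfolding set_lebesgue_integral_def real_scaleR_def eq
    using iFg iGf iF iG by (simp add: IF IG)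
  also have "\<dots> = f b * g b - f a * g a"
    unfolding key[symmetric] by (simp add: algebra_simps)
  finally show "f b * g b - f a * g a = (LINT x:{a<..b}|lborel. f' x * g x + f x * g' x)" ..
qed

lemma RN_derivative_of_power:
  assumes q: "RN_derivative_of q q'" and [measurable]: "q \<in> borel_measurable borel"
  shows "RN_derivative_of (\<lambda>x. q x ^ Suc k) (\<lambda>x. real (Suc k) * (q x ^ k * q' x))"
proof (induction k)
  case (Suc k)
  have "RN_derivative_of (\<lambda>x. q x * q x ^ Suc k)
     (\<lambda>x. q' x * q x ^ Suc k + q x * (real (Suc k) * (q x ^ k * q' x)))"
    by (rule RN_derivative_of_mult[OF q Suc.IH]) measurable
  also have "(\<lambda>x. q' x * q x ^ Suc k + q x * (real (Suc k) * (q x ^ k * q' x)))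
    = (\<lambda>x. real (Suc (Suc k)) * (q x ^ Suc k * q' x))"
    by (auto simp: algebra_simps)
  finally show ?case by simp
qed (use q in simp)

lemma RN_derivative_of_affine:
  assumes "RN_derivative_of f f'"
  shows "RN_derivative_of (\<lambda>x. c + d * f x) (\<lambda>x. d * f' x)"
  using assms unfolding RN_derivative_of_def
  by (auto simp: right_diff_distrib[symmetric])

text \<open>A nonnegative \<open>p\<close> has derivative 0 almost everywhere on its zero set, so \<open>p'\<close> may be
  replaced by 0 there. This makes \<open>p'\<close> equal to \<open>p\<close> times the score, which is what the Fisher information
  controls. Instead of pointwise derivatives the proof uses powers: if \<open>q = 1 - p / B\<close> takes values in
  \<open>[0, 1]\<close> on \<open>{a..b}\<close>, the power rule shows that \<open>\<integral>q ^ k * p'\<close> is at most of order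
  \<open>1 / (k + 1)\<close>, while \<open>q ^ k\<close> tends to the indicator of \<open>{p = 0}\<close>.\<close>
lemma RN_derivative_of_restrict_positive:
  assumes p: "RN_derivative_of p p'" and nn: "\<And>x. 0 \<le> p x"
    and [measurable]: "p \<in> borel_measurable borel"
  shows "RN_derivative_of p (\<lambda>x. p' x * indicator {x. 0 < p x} x)"
proof -
  note D = RN_derivative_ofD[OF p]
  note [measurable] = D(1)
  have zero: "(LINT x:{a<..b}|lborel. p' x * indicator {x. p x = 0} x) = 0" if ab: "a \<le> b" for a b
  proof -
    define B where "B = 1 + p a + (LINT y:{a<..b}|lborel. \<bar>p' y\<bar>)"
    have B: "p x < B" "B > 0" if "x \<in> {a..b}" for x
    proof -
      show *: "p x < B" using abs_RN_increment_le[OF p, of a x b] that by (auto simp: B_def)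
      show "B > 0" using * nn[of x] by linarith
    qed
    \<comment> \<open>On \<open>{a..b}\<close> the function \<open>p\<close> stays below \<open>B\<close>, so \<open>q\<close> lies in \<open>[0, 1]\<close>, with value 1 exactly at the zeros of \<open>p\<close>.\<close>
    define q where "q x = 1 + (- 1 / B) * p x" for x
    have B0: "B > 0" using B(2)[of a] ab by auto
    have q: "RN_derivative_of q (\<lambda>x. (- 1 / B) * p' x)"
      unfolding q_def by (rule RN_derivative_of_affine[OF p])
    have [measurable]: "q \<in> borel_measurable borel" unfolding q_def by measurable
    have q01: "0 \<le> q x" "q x \<le> 1" "q x = 1 \<longleftrightarrow> p x = 0" if "x \<in> {a..b}" for x
      using B(1)[OF that] nn[of x] B0 by (auto simp: q_def field_simps)
    have I: "(LINT x:{a<..b}|lborel. q x ^ k * p' x) = - B * (q b ^ Suc k - q a ^ Suc k) / real (Suc k)" for k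
    proof -
      have "q b ^ Suc k - q a ^ Suc k = (LINT x:{a<..b}|lborel. real (Suc k) * (q x ^ k * ((- 1 / B) * p' x)))"
        using RN_derivative_ofD(3)[OF RN_derivative_of_power[OF q] ab] by simp
      also have "\<dots> = (LINT x:{a<..b}|lborel. (- real (Suc k) / B) * (q x ^ k * p' x))"
        by (simp only: mult.assoc mult.left_commute mult.commute times_divide_eq_left times_divide_eq_right mult_minus_left mult_minus_right mult_1_left mult_1_right divide_minus_left)
      also have "\<dots> = (- real (Suc k) / B) * (LINT x:{a<..b}|lborel. q x ^ k * p' x)"
        by (rule set_integral_mult_right)
      finally show ?thesis using B0 by (simp add: field_simps)
    qed
    have "(\<lambda>k. - B * (q b ^ Suc k - q a ^ Suc k) / real (Suc k)) \<longlonglongrightarrow> 0"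
    proof (rule Lim_null_comparison)
      show "(\<lambda>k. B * inverse (real (Suc k))) \<longlonglongrightarrow> 0"
        using LIMSEQ_inverse_real_of_nat by (rule tendsto_mult_right_zero)
      have "norm (- B * (q b ^ Suc k - q a ^ Suc k) / real (Suc k)) \<le> B * inverse (real (Suc k))" for k
      proof -
        have "\<bar>q b ^ Suc k - q a ^ Suc k\<bar> \<le> 1"
          using q01(1,2)[of a] q01(1,2)[of b] ab power_le_one[of "q a" "Suc k"] power_le_one[of "q b" "Suc k"]
            zero_le_power[of "q a" "Suc k"] zero_le_power[of "q b" "Suc k"]
          unfolding abs_le_iff atLeastAtMost_iff by linarith
        then have "B * \<bar>q b ^ Suc k - q a ^ Suc k\<bar> * inverse (real (Suc k)) \<le> B * 1 * inverse (real (Suc k))"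
          using B0 by (intro mult_right_mono mult_left_mono) auto
        then show ?thesis
          by (simp only: real_norm_def abs_divide abs_mult abs_minus_cancel abs_of_pos[OF B0] abs_of_nat
              divide_inverse abs_inverse mult_1_right)
      qed
      then show "\<forall>\<^sub>F k in sequentially. norm (- B * (q b ^ Suc k - q a ^ Suc k) / real (Suc k)) \<le> B * inverse (real (Suc k))"
        by simp
    qed
    then have "(\<lambda>k. LINT x:{a<..b}|lborel. q x ^ k * p' x) \<longlonglongrightarrow> 0"
      by (simp only: I)
    moreover have "(\<lambda>k. LINT x:{a<..b}|lborel. q x ^ k * p' x)
        \<longlonglongrightarrow> (LINT x:{a<..b}|lborel. p' x * indicator {x. p x = 0} x)"
      unfolding set_lebesgue_integral_def
    proof (rule integral_dominated_convergence[where w = "\<lambda>x. \<bar>indicator {a<..b} x *\<^sub>R p' x\<bar>"])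
      show "integrable lborel (\<lambda>x. \<bar>indicator {a<..b} x *\<^sub>R p' x\<bar>)"
        using D(2)[OF ab] by (auto simp: set_integrable_def)
      show "AE x in lborel. norm (indicator {a<..b} x *\<^sub>R (q x ^ k * p' x)) \<le> \<bar>indicator {a<..b} x *\<^sub>R p' x\<bar>" for k
      proof (rule AE_I2)
        fix x
        show "norm (indicator {a<..b} x *\<^sub>R (q x ^ k * p' x)) \<le> \<bar>indicator {a<..b} x *\<^sub>R p' x\<bar>"
          using q01[of x] power_le_one[of "q x" k] by (auto simp: abs_mult mult_left_le_one_le split: split_indicator)
      qed
      show "AE x in lborel. (\<lambda>k. indicator {a<..b} x *\<^sub>R (q x ^ k * p' x))
          \<longlonglongrightarrow> indicator {a<..b} x *\<^sub>R (p' x * indicator {x. p x = 0} x)"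
      proof (rule AE_I2)
        fix x
        show "(\<lambda>k. indicator {a<..b} x *\<^sub>R (q x ^ k * p' x))
          \<longlonglongrightarrow> indicator {a<..b} x *\<^sub>R (p' x * indicator {x. p x = 0} x)"
        proof (cases "x \<in> {a<..b}")
          case True
          show ?thesis
          proof (cases "p x = 0")
            case True then show ?thesis by (simp add: q_def)
          next
            case False
            then have "q x < 1" "0 \<le> q x" using q01[of x] True by auto
            then have "(\<lambda>k. q x ^ k * p' x) \<longlonglongrightarrow> 0"
              by (intro tendsto_mult_left_zero LIMSEQ_realpow_zero)
            with False True show ?thesis by simp
          qed
        qed simp
      qed
    qed measurable
    ultimately show ?thesis by (rule LIMSEQ_unique[symmetric])
  qed
  show ?thesis
    unfolding RN_derivative_of_def
  proof (intro conjI allI impI)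
    show "(\<lambda>x. p' x * indicator {x. 0 < p x} x) \<in> borel_measurable borel" by measurable
    fix a b :: real assume ab: "a \<le> b"
    have i: "set_integrable lborel {a<..b} (\<lambda>x. p' x * indicator S x)" if "S \<in> sets borel" for S
      using integrable_real_mult_indicator[of S lborel "\<lambda>x. indicator {a<..b} x * p' x"] D(2)[OF ab] that
      by (simp add: set_integrable_def mult.assoc)
    show "set_integrable lborel {a<..b} (\<lambda>x. p' x * indicator {x. 0 < p x} x)"
      by (rule i) measurable
    have "p b - p a = (LINT x:{a<..b}|lborel. p' x * indicator {x. 0 < p x} x + p' x * indicator {x. p x = 0} x)"
      using nn unfolding D(3)[OF ab]
      by (intro set_lebesgue_integral_cong) (auto split: split_indicator simp: less_le)
    also have "\<dots> = (LINT x:{a<..b}|lborel. p' x * indicator {x. 0 < p x} x)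
       + (LINT x:{a<..b}|lborel. p' x * indicator {x. p x = 0} x)"
      by (intro set_integral_add i) measurable
    finally show "p b - p a = (LINT x:{a<..b}|lborel. p' x * indicator {x. 0 < p x} x)"
      using zero[OF ab] by simp
  qed
qed

section \<open>Scores and translations\<close>

text \<open>As a function of \<open>u\<close> this is an antiderivative of \<open>h (u + t) - h u\<close>, and it is bounded by
  \<open>t\<close> as soon as \<open>\<bar>h\<bar> \<le> 1\<close>. The window is open on the right because the increments of \<open>p\<close> are
  integrals over \<open>{x - t<..x}\<close>, and \<open>u \<in> {x - t<..x}\<close> means \<open>x \<in> {u..<u + t}\<close>.\<close>
definition window_integral :: "(real \<Rightarrow> real) \<Rightarrow> real \<Rightarrow> real \<Rightarrow> real" where
  "window_integral h t u = (LINT z:{0..<t}|lborel. h (u + z))"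

lemma borel_measurable_window_integral [measurable]:
  assumes [measurable]: "h \<in> borel_measurable borel"
  shows "window_integral h t \<in> borel_measurable borel"
  unfolding window_integral_def[abs_def] set_lebesgue_integral_def by measurable

lemma abs_window_integral_le:
  assumes [measurable]: "h \<in> borel_measurable borel" and "\<And>x. \<bar>h x\<bar> \<le> 1" "0 \<le> t"
  shows "\<bar>window_integral h t u\<bar> \<le> t"
proof -
  have "\<bar>window_integral h t u\<bar> \<le> (LINT z:{0..<t}|lborel. 1)"
    unfolding window_integral_def set_lebesgue_integral_def
  proof (rule integral_abs_bound_integral)
    show "integrable lborel (\<lambda>x. indicat_real {0..<t} x *\<^sub>R (1::real))" using assms(3) by simp
    then show "integrable lborel (\<lambda>z. indicat_real {0..<t} z *\<^sub>R h (u + z))"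
      by (rule Bochner_Integration.integrable_bound) (auto split: split_indicator simp: assms(2))
  qed (auto split: split_indicator simp: assms(2))
  then show ?thesis using assms(3) by (simp add: set_lebesgue_integral_def)
qed

text \<open>Integration by parts without any regularity of \<open>h\<close>: moving the translation from \<open>h\<close> to \<open>p\<close> leaves
  \<open>- \<integral>h x * (p x - p (x - t))\<close>; writing the increment of \<open>p\<close> as an integral of \<open>g\<close> and exchanging
  the integrals integrates \<open>h\<close> over a window instead.\<close>
lemma integral_translate_eq_window:
  fixes p g h :: "real \<Rightarrow> real"
  assumes rn: "RN_derivative_of p g" and ig: "integrable lborel g" and ip: "integrable lborel p"
    and [measurable]: "h \<in> borel_measurable borel" and h1: "\<And>x. \<bar>h x\<bar> \<le> 1" and t: "0 \<le> t"
  shows "(LINT x|lborel. p x * (h (x + t) - h x)) = - (LINT u|lborel. g u * window_integral h t u)"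
proof -
  have [measurable]: "p \<in> borel_measurable borel" "g \<in> borel_measurable borel"
    using borel_measurable_integrable[OF ip] borel_measurable_integrable[OF ig] by simp_all
  have ip': "integrable lborel (\<lambda>x. p (x - t))"
    using lborel_integrable_real_affine[OF ip, of 1 "-t"] by (simp add: add.commute)
  have bnd: "integrable lborel (\<lambda>x. q x * k x)"
    if "integrable lborel q" "k \<in> borel_measurable borel" "\<And>x. \<bar>k x\<bar> \<le> 1" for q k :: "real \<Rightarrow> real"
    using that by (intro Bochner_Integration.integrable_bound[OF that(1)])
      (auto simp: abs_mult intro!: AE_I2 mult_left_le)
  have i1: "integrable lborel (\<lambda>x. p x * h x)" "integrable lborel (\<lambda>x. p x * h (x + t))"
    "integrable lborel (\<lambda>x. p (x - t) * h x)"
    by (intro bnd ip ip' h1; measurable)+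
  have "(LINT x|lborel. p x * (h (x + t) - h x)) = (LINT x|lborel. p x * h (x + t)) - (LINT x|lborel. p x * h x)"
    using i1 by (simp add: right_diff_distrib)
  also have "(LINT x|lborel. p x * h (x + t)) = (LINT x|lborel. p (x - t) * h x)"
    by (subst lborel_integral_real_affine[where c = 1 and t = "-t"]) auto
  also have "(LINT x|lborel. p (x - t) * h x) - (LINT x|lborel. p x * h x)
      = - (LINT x|lborel. h x * (p x - p (x - t)))"
    using i1 by (simp add: right_diff_distrib mult.commute)
  also have "(LINT x|lborel. h x * (p x - p (x - t)))
      = (LINT x|lborel. LINT u|lborel. h x * (g u * indicator {x-t<..x} u))"
    using RN_derivative_ofD(3)[OF rn, of "x - t" x for x] t
    by (intro Bochner_Integration.integral_cong) (auto simp: set_lebesgue_integral_def mult.commute)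
  also have "\<dots> = (LINT u|lborel. LINT x|lborel. h x * (g u * indicator {x-t<..x} u))"
  proof (rule lborel_pair.Fubini_integral)
    have "(\<lambda>(u, x). h x * (g u * indicator {x - t<..x} u))
        = (\<lambda>z. h (snd z) * (g (fst z) * (if snd z - t < fst z \<and> fst z \<le> snd z then 1 else 0)))"
      by (auto simp: fun_eq_iff)
    also have "\<dots> \<in> borel_measurable (lborel \<Otimes>\<^sub>M lborel)" by measurable
    finally have pm: "(\<lambda>(u, x). h x * (g u * indicator {x - t<..x} u)) \<in> borel_measurable (lborel \<Otimes>\<^sub>M lborel)" .
    have flip: "indicator {x - t<..x} u = indicat_real {u..<u+t} x" for x u
      by (auto split: split_indicator)
    have ii: "integrable lborel (\<lambda>x. h x * (c * indicator {x - t<..x} u))" for u c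
    proof (rule Bochner_Integration.integrable_bound)
      show "integrable lborel (\<lambda>x. c * indicat_real {u..<u+t} x)" using t by simp
    qed (auto simp: flip abs_mult intro!: mult_left_le_one_le h1)
    show "integrable (lborel \<Otimes>\<^sub>M lborel) (\<lambda>(u, x). h x * (g u * indicator {x - t<..x} u))"
    proof (rule lborel_pair.Fubini_integrable)
      show "integrable lborel (\<lambda>u. LINT x|lborel. norm (case (u, x) of (u, x) \<Rightarrow> h x * (g u * indicator {x - t<..x} u)))"
      proof (rule Bochner_Integration.integrable_bound)
        show "integrable lborel (\<lambda>u. t * g u)" using ig by simp
        show "AE u in lborel. norm (LINT x|lborel. norm (case (u, x) of (u, x) \<Rightarrow> h x * (g u * indicator {x - t<..x} u)))
            \<le> norm (t * g u)"
        proof (rule AE_I2)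
          fix u
          have "(LINT x|lborel. norm (h x * (g u * indicator {x - t<..x} u)))
              \<le> (LINT x|lborel. \<bar>g u\<bar> * indicat_real {u..<u+t} x)"
            using t by (intro integral_mono integrable_norm ii)
              (auto simp: flip abs_mult intro!: mult_left_le_one_le h1)
          then show "norm (LINT x|lborel. norm (case (u, x) of (u, x) \<Rightarrow> h x * (g u * indicator {x - t<..x} u)))
            \<le> norm (t * g u)" using t by (simp add: integral_nonneg_AE abs_of_nonneg abs_mult mult.commute)
        qed
      qed (use pm in measurable)
    qed (use pm ii in auto)
  qed
  also have "\<dots> = (LINT u|lborel. g u * window_integral h t u)"
  proof (rule Bochner_Integration.integral_cong[OF refl])
    fix u
    have "(LINT x|lborel. h x * (g u * indicator {x-t<..x} u))
        = (LINT z|lborel. h (u + z) * (g u * indicator {u + z - t<..u + z} u))"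
      by (subst lborel_integral_real_affine[where c = 1 and t = u]) auto
    also have "\<dots> = (LINT z|lborel. g u * (indicator {0..<t} z * h (u + z)))"
      by (intro Bochner_Integration.integral_cong) (auto split: split_indicator)
    finally show "(LINT x|lborel. h x * (g u * indicator {x-t<..x} u)) = g u * window_integral h t u"
      by (simp add: window_integral_def set_lebesgue_integral_def)
  qed
  finally show ?thesis .
qed

text \<open>The integrated form of Stein's identity \<open>E (f' (X)) = - E (f (X) * \<rho> (X))\<close>. It speaks of the law of \<open>X\<close> only through
  expectations of bounded functions, so it survives the addition of an independent variable
  without convolving densities.\<close>
definition (in prob_space) weak_score :: "('a \<Rightarrow> real) \<Rightarrow> (real \<Rightarrow> real) \<Rightarrow> bool" where
  "weak_score X \<rho> \<longleftrightarrow>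
     random_variable borel X \<and> \<rho> \<in> borel_measurable borel \<and>
     integrable M (\<lambda>\<omega>. (\<rho> (X \<omega>))\<^sup>2) \<and> expectation (\<lambda>\<omega>. \<rho> (X \<omega>)) = 0 \<and>
     (\<forall>h t. h \<in> borel_measurable borel \<longrightarrow> (\<forall>x. \<bar>h x\<bar> \<le> 1) \<longrightarrow> 0 \<le> t \<longrightarrow>
        expectation (\<lambda>\<omega>. h (X \<omega> + t) - h (X \<omega>))
          = - expectation (\<lambda>\<omega>. window_integral h t (X \<omega>) * \<rho> (X \<omega>)))"

text \<open>Finiteness of \<open>E (\<rho> (X))\<^sup>2\<close> makes \<open>p'\<close> integrable on \<open>{p > 0}\<close>, so that the integration by
  parts over the whole line applies. The score is centred by the identity for \<open>h = 1\<close> and \<open>t = 1\<close>,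
  whose window integral is constantly 1.\<close>
lemma (in prob_space) weak_score_quotient:
  assumes d: "distributed M lborel X (\<lambda>x. ennreal (p x))" and nn: "\<And>x. 0 \<le> p x"
    and rn: "RN_derivative_of p p'"
    and fin: "(\<integral>\<^sup>+\<omega>. ennreal ((p' (X \<omega>) / p (X \<omega>))\<^sup>2) \<partial>M) < \<infinity>"
  shows "weak_score X (\<lambda>x. p' x / p x)"
proof -
  have [measurable]: "random_variable borel X"
    using distributed_measurable[OF d] by simp
  note [measurable] = RN_derivative_ofD(1)[OF rn]
  have "(\<lambda>x. enn2real (ennreal (p x))) \<in> borel_measurable lborel"
    using distributed_borel_measurable[OF d] by measurable
  then have [measurable]: "p \<in> borel_measurable borel"
    using nn by simp
  define g where "g x = p' x * indicator {x. 0 < p x} x" for x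
  have rn': "RN_derivative_of p g"
    unfolding g_def by (rule RN_derivative_of_restrict_positive[OF rn nn]) measurable
  have [measurable]: "g \<in> borel_measurable borel"
    unfolding g_def by measurable
  define \<rho> where "\<rho> x = p' x / p x" for x
  have [measurable]: "\<rho> \<in> borel_measurable borel" unfolding \<rho>_def by measurable
  have g_eq: "g x = p x * \<rho> x" for x
    using nn[of x] by (auto simp: g_def \<rho>_def split: split_indicator)
  have sq: "integrable M (\<lambda>\<omega>. (\<rho> (X \<omega>))\<^sup>2)"
    using fin unfolding \<rho>_def by (intro integrableI_bounded) auto
  then have i\<rho>: "integrable M (\<lambda>\<omega>. \<rho> (X \<omega>))"
    by (rule square_integrable_imp_integrable[rotated]) measurable
  have ip: "integrable lborel p"
    using distributed_integrable[OF d, of "\<lambda>_. 1"] nn by simp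
  have ig: "integrable lborel g"
    using i\<rho> distributed_integrable[OF d, of \<rho>] nn by (simp add: g_eq[abs_def])
  have id: "expectation (\<lambda>\<omega>. h (X \<omega> + t) - h (X \<omega>)) = - expectation (\<lambda>\<omega>. window_integral h t (X \<omega>) * \<rho> (X \<omega>))"
    if [measurable]: "h \<in> borel_measurable borel" and h1: "\<And>x. \<bar>h x\<bar> \<le> 1" and t: "0 \<le> t" for h t
  proof -
    have "expectation (\<lambda>\<omega>. h (X \<omega> + t) - h (X \<omega>)) = (LINT x|lborel. p x * (h (x + t) - h x))"
      by (rule distributed_integral[OF d, symmetric]) (auto simp: nn)
    also have "\<dots> = - (LINT x|lborel. p x * (window_integral h t x * \<rho> x))"
      by (subst integral_translate_eq_window[OF rn' ig ip, of h t]) (auto simp: g_eq ac_simps h1 t)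
    also have "(LINT x|lborel. p x * (window_integral h t x * \<rho> x))
        = expectation (\<lambda>\<omega>. window_integral h t (X \<omega>) * \<rho> (X \<omega>))"
      by (rule distributed_integral[OF d]) (auto simp: nn)
    finally show ?thesis .
  qed
  have "expectation (\<lambda>\<omega>. \<rho> (X \<omega>)) = 0"
    using id[of "\<lambda>_. 1" 1] by (simp add: window_integral_def set_lebesgue_integral_def)
  with sq id show ?thesis unfolding weak_score_def \<rho>_def[symmetric] by auto
qed

text \<open>For a fixed value \<open>y\<close> of \<open>T\<close> this is the defining identity of the score for the translate
  \<open>h (\<cdot> + y)\<close>; independence lets Fubini integrate it over the law of \<open>T\<close>.\<close>
lemma (in prob_space) weak_score_indep_sum:
  assumes X: "weak_score X \<rho>" and ind: "indep_var borel X borel T"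
    and [measurable]: "h \<in> borel_measurable borel" and h1: "\<And>x. \<bar>h x\<bar> \<le> 1" and t: "0 \<le> t"
  shows "expectation (\<lambda>\<omega>. h (X \<omega> + T \<omega> + t) - h (X \<omega> + T \<omega>))
    = - expectation (\<lambda>\<omega>. window_integral h t (X \<omega> + T \<omega>) * \<rho> (X \<omega>))"
proof -
  have [measurable]: "random_variable borel X" "\<rho> \<in> borel_measurable borel"
    and sq: "integrable M (\<lambda>\<omega>. (\<rho> (X \<omega>))\<^sup>2)"
    using X by (auto simp: weak_score_def)
  have [measurable]: "random_variable borel T" using ind by (rule indep_var_rv2)
  have i\<rho>: "integrable M (\<lambda>\<omega>. \<rho> (X \<omega>))"
    by (rule square_integrable_imp_integrable[OF _ sq]) measurable
  have W: "\<bar>window_integral h t u\<bar> \<le> t" for u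
    by (rule abs_window_integral_le) (auto simp: h1 t)
  have iW: "integrable M (\<lambda>\<omega>. window_integral h t (Y \<omega>) * \<rho> (X \<omega>))" 
    if [measurable]: "random_variable borel Y" for Y
  proof (rule Bochner_Integration.integrable_bound)
    show "integrable M (\<lambda>\<omega>. t * \<rho> (X \<omega>))" using i\<rho> by simp
    show "AE \<omega> in M. norm (window_integral h t (Y \<omega>) * \<rho> (X \<omega>)) \<le> norm (t * \<rho> (X \<omega>))"
      using W t by (auto simp: abs_mult intro!: mult_right_mono)
  qed measurable
  have ih: "integrable M (\<lambda>\<omega>. h (Y \<omega>))" if [measurable]: "random_variable borel Y" for Y
    by (rule integrable_const_bound[where B = 1]) (auto simp: h1)
  \<comment> \<open>The claim is that \<open>\<psi>\<close> has expectation 0 at \<open>(X, T)\<close>; it has for each fixed second argument.\<close>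
  define \<psi> where "\<psi> z = h (fst z + snd z + t) - h (fst z + snd z)
      + window_integral h t (fst z + snd z) * \<rho> (fst z)" for z
  have [measurable]: "\<psi> \<in> borel_measurable (borel \<Otimes>\<^sub>M borel)" unfolding \<psi>_def by measurable
  have i\<psi>: "integrable M (\<lambda>\<omega>. \<psi> (X \<omega>, T \<omega>))" and i\<psi>': "integrable M (\<lambda>\<omega>. \<psi> (X \<omega>, y))" for y
    unfolding \<psi>_def fst_conv snd_conv by (intro Bochner_Integration.integrable_add Bochner_Integration.integrable_diff ih iW; measurable)+
  have D: "distr M borel X \<Otimes>\<^sub>M distr M borel T = distr M (borel \<Otimes>\<^sub>M borel) (\<lambda>\<omega>. (X \<omega>, T \<omega>))"
    using ind by (simp add: indep_var_distribution_eq)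
  interpret DX: prob_space "distr M borel X" by (rule prob_space_distr) measurable
  interpret DT: prob_space "distr M borel T" by (rule prob_space_distr) measurable
  interpret P: pair_sigma_finite "distr M borel X" "distr M borel T" ..
  have inner: "expectation (\<lambda>\<omega>. \<psi> (X \<omega>, y)) = 0" for y
  proof -
    have w: "window_integral (\<lambda>x. h (x + y)) t u = window_integral h t (u + y)" for u
      by (simp add: window_integral_def ac_simps)
    have "expectation (\<lambda>\<omega>. h (X \<omega> + t + y) - h (X \<omega> + y))
        = - expectation (\<lambda>\<omega>. window_integral (\<lambda>x. h (x + y)) t (X \<omega>) * \<rho> (X \<omega>))"
      using X t h1 unfolding weak_score_def by (elim conjE allE[of _ "\<lambda>x. h (x + y)"] allE[of _ t]) auto
    then have "expectation (\<lambda>\<omega>. h (X \<omega> + y + t) - h (X \<omega> + y))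
        = - expectation (\<lambda>\<omega>. window_integral h t (X \<omega> + y) * \<rho> (X \<omega>))"
      unfolding w by (simp add: ac_simps)
    moreover have "expectation (\<lambda>\<omega>. \<psi> (X \<omega>, y)) = expectation (\<lambda>\<omega>. h (X \<omega> + y + t) - h (X \<omega> + y))
        + expectation (\<lambda>\<omega>. window_integral h t (X \<omega> + y) * \<rho> (X \<omega>))"
      unfolding \<psi>_def fst_conv snd_conv
      by (intro Bochner_Integration.integral_add Bochner_Integration.integrable_diff ih iW) measurable
    ultimately show ?thesis by simp
  qed
  have "expectation (\<lambda>\<omega>. \<psi> (X \<omega>, T \<omega>)) = integral\<^sup>L (distr M borel X \<Otimes>\<^sub>M distr M borel T) \<psi>"
    unfolding D by (rule integral_distr[symmetric]) measurable
  also have "\<dots> = (LINT y|distr M borel T. LINT x|distr M borel X. \<psi> (x, y))"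
  proof -
    have "integrable (distr M borel X \<Otimes>\<^sub>M distr M borel T) \<psi>"
      unfolding D using i\<psi> by (subst integrable_distr_eq) auto
    then show ?thesis
      using P.integral_snd[of "\<lambda>x y. \<psi> (x, y)"] by simp
  qed
  also have "\<dots> = (LINT y|distr M borel T. 0)"
    by (intro Bochner_Integration.integral_cong refl) (subst integral_distr, auto simp: inner)
  finally have "expectation (\<lambda>\<omega>. \<psi> (X \<omega>, T \<omega>)) = 0" by simp
  moreover have "expectation (\<lambda>\<omega>. \<psi> (X \<omega>, T \<omega>)) = expectation (\<lambda>\<omega>. h (X \<omega> + T \<omega> + t) - h (X \<omega> + T \<omega>))
        + expectation (\<lambda>\<omega>. window_integral h t (X \<omega> + T \<omega>) * \<rho> (X \<omega>))"
    unfolding \<psi>_def fst_conv snd_conv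
    by (intro Bochner_Integration.integral_add Bochner_Integration.integrable_diff ih iW) measurable
  ultimately show ?thesis by simp
qed

lemma (in prob_space) weak_score_translation_bound:
  assumes X: "weak_score X \<rho>"
    and [measurable]: "h \<in> borel_measurable borel" and h1: "\<And>x. \<bar>h x\<bar> \<le> 1" and t: "0 \<le> t"
  shows "\<bar>expectation (\<lambda>\<omega>. h (X \<omega> + t)) - expectation (\<lambda>\<omega>. h (X \<omega>))\<bar> \<le> expectation (\<lambda>\<omega>. \<bar>\<rho> (X \<omega>)\<bar>) * t"
proof -
  have [measurable]: "random_variable borel X" "\<rho> \<in> borel_measurable borel"
    and sq: "integrable M (\<lambda>\<omega>. (\<rho> (X \<omega>))\<^sup>2)"
    and id: "expectation (\<lambda>\<omega>. h (X \<omega> + t) - h (X \<omega>))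
      = - expectation (\<lambda>\<omega>. window_integral h t (X \<omega>) * \<rho> (X \<omega>))"
    using X h1 t by (auto simp: weak_score_def)
  have i\<rho>: "integrable M (\<lambda>\<omega>. \<rho> (X \<omega>))"
    by (rule square_integrable_imp_integrable[OF _ sq]) measurable
  have W: "\<bar>window_integral h t u\<bar> \<le> t" for u
    by (rule abs_window_integral_le) (auto simp: h1 t)
  have ih: "integrable M (\<lambda>\<omega>. h (Y \<omega>))" if [measurable]: "random_variable borel Y" for Y
    by (rule integrable_const_bound[where B = 1]) (auto simp: h1)
  have "expectation (\<lambda>\<omega>. h (X \<omega> + t)) - expectation (\<lambda>\<omega>. h (X \<omega>)) = expectation (\<lambda>\<omega>. h (X \<omega> + t) - h (X \<omega>))"
    by (intro Bochner_Integration.integral_diff[symmetric] ih) measurable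
  then have "\<bar>expectation (\<lambda>\<omega>. h (X \<omega> + t)) - expectation (\<lambda>\<omega>. h (X \<omega>))\<bar>
      = \<bar>expectation (\<lambda>\<omega>. window_integral h t (X \<omega>) * \<rho> (X \<omega>))\<bar>"
    by (simp add: id)
  also have "\<dots> \<le> expectation (\<lambda>\<omega>. \<bar>window_integral h t (X \<omega>) * \<rho> (X \<omega>)\<bar>)"
    by (rule integral_abs_bound)
  also have "\<dots> \<le> expectation (\<lambda>\<omega>. \<bar>\<rho> (X \<omega>)\<bar> * t)"
    by (rule integral_mono_AE') (use i\<rho> W in \<open>auto simp: abs_mult mult.commute[of _ t] t intro!: mult_right_mono\<close>)
  finally show ?thesis by simp
qed

lemma (in prob_space) expectation_square_sum_indep:
  fixes Y :: "'i \<Rightarrow> 'a \<Rightarrow> real"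
  assumes "finite I" "indep_vars (\<lambda>_. borel) Y I"
    and "\<And>i. i \<in> I \<Longrightarrow> integrable M (\<lambda>\<omega>. (Y i \<omega>)\<^sup>2)" "\<And>i. i \<in> I \<Longrightarrow> expectation (Y i) = 0"
  shows "integrable M (\<lambda>\<omega>. (\<Sum>i\<in>I. Y i \<omega>)\<^sup>2) \<and>
    expectation (\<lambda>\<omega>. (\<Sum>i\<in>I. Y i \<omega>)\<^sup>2) = (\<Sum>i\<in>I. expectation (\<lambda>\<omega>. (Y i \<omega>)\<^sup>2))"
  using assms
proof (induction I rule: finite_induct)
  case (insert i I)
  have rv [measurable]: "\<And>j. j \<in> insert i I \<Longrightarrow> random_variable borel (Y j)"
    using insert.prems(1) by (auto simp: indep_vars_def)
  have [measurable]: "random_variable borel (Y i)" by (rule rv) simp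
  have [measurable]: "random_variable borel (\<lambda>\<omega>. \<Sum>j\<in>I. Y j \<omega>)"
    by (intro borel_measurable_sum rv) simp
  have ind: "indep_var borel (Y i) borel (\<lambda>\<omega>. \<Sum>j\<in>I. Y j \<omega>)"
    by (rule indep_vars_sum) (use insert in auto)
  have IH: "integrable M (\<lambda>\<omega>. (\<Sum>j\<in>I. Y j \<omega>)\<^sup>2)"
    "expectation (\<lambda>\<omega>. (\<Sum>j\<in>I. Y j \<omega>)\<^sup>2) = (\<Sum>j\<in>I. expectation (\<lambda>\<omega>. (Y j \<omega>)\<^sup>2))"
    using insert.IH insert.prems indep_vars_subset[OF insert.prems(1), of I] by auto
  have i1: "integrable M (Y i)" "integrable M (\<lambda>\<omega>. \<Sum>j\<in>I. Y j \<omega>)"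
    by (rule square_integrable_imp_integrable; use IH insert.prems in simp)+
  have cross: "integrable M (\<lambda>\<omega>. Y i \<omega> * (\<Sum>j\<in>I. Y j \<omega>))"
    "expectation (\<lambda>\<omega>. Y i \<omega> * (\<Sum>j\<in>I. Y j \<omega>)) = 0"
    using indep_var_integrable[OF ind i1] indep_var_lebesgue_integral[OF ind i1] insert.prems(3)[of i] by auto
  have eq: "(\<Sum>j\<in>insert i I. Y j \<omega>)\<^sup>2 = (Y i \<omega>)\<^sup>2 + (\<Sum>j\<in>I. Y j \<omega>)\<^sup>2 + 2 * (Y i \<omega> * (\<Sum>j\<in>I. Y j \<omega>))" for \<omega>
    using insert.hyps by (simp add: power2_sum)
  show ?case
    unfolding eq using IH cross insert.prems(2)[of i] insert.hyps by simp
qed simp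

text \<open>Each score \<open>\<rho> i (X i)\<close> represents the same difference of expectations, hence so does every
  combination of them whose weights sum to 1. By independence the second moment of the combination
  has the squared weights, so spreading the weights makes it small.\<close>
lemma (in prob_space) translation_bound_indep_sum:
  fixes X :: "'i \<Rightarrow> 'a \<Rightarrow> real" and a :: "'i \<Rightarrow> real"
  assumes fin: "finite I" and ind: "indep_vars (\<lambda>_. borel) X I"
    and sc: "\<And>i. i \<in> I \<Longrightarrow> weak_score (X i) (\<rho> i)" and a: "(\<Sum>i\<in>I. a i) = 1"
    and [measurable]: "h \<in> borel_measurable borel" and h1: "\<And>x. \<bar>h x\<bar> \<le> 1" and t: "0 \<le> t"
  shows "\<bar>expectation (\<lambda>\<omega>. h ((\<Sum>i\<in>I. X i \<omega>) + t)) - expectation (\<lambda>\<omega>. h (\<Sum>i\<in>I. X i \<omega>))\<bar>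
    \<le> t * sqrt (\<Sum>i\<in>I. (a i)\<^sup>2 * expectation (\<lambda>\<omega>. (\<rho> i (X i \<omega>))\<^sup>2))"
proof -
  define \<Sigma> where "\<Sigma> \<omega> = (\<Sum>i\<in>I. X i \<omega>)" for \<omega>
  have rv: "\<And>i. i \<in> I \<Longrightarrow> random_variable borel (X i)" using ind by (auto simp: indep_vars_def)
  have [measurable]: "random_variable borel \<Sigma>"
    unfolding \<Sigma>_def by (intro borel_measurable_sum rv)
  have S: "\<rho> i \<in> borel_measurable borel" "integrable M (\<lambda>\<omega>. (\<rho> i (X i \<omega>))\<^sup>2)"
    "expectation (\<lambda>\<omega>. \<rho> i (X i \<omega>)) = 0" if "i \<in> I" for i
    using sc[OF that] by (auto simp: weak_score_def)
  have m\<rho>: "random_variable borel (\<lambda>\<omega>. \<rho> i (X i \<omega>))" if "i \<in> I" for i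
    using S(1)[OF that] rv[OF that] by measurable
  have i\<rho>: "integrable M (\<lambda>\<omega>. \<rho> i (X i \<omega>))" if "i \<in> I" for i
    by (rule square_integrable_imp_integrable[OF m\<rho>[OF that] S(2)[OF that]])
  have W: "\<bar>window_integral h t u\<bar> \<le> t" for u
    by (rule abs_window_integral_le) (auto simp: h1 t)
  have ih: "integrable M (\<lambda>\<omega>. h (Y \<omega>))" if [measurable]: "random_variable borel Y" for Y
    by (rule integrable_const_bound[where B = 1]) (auto simp: h1)
  have iW: "integrable M (\<lambda>\<omega>. window_integral h t (\<Sigma> \<omega>) * R \<omega>)" 
    if "integrable M R" for R
  proof (rule Bochner_Integration.integrable_bound)
    show "integrable M (\<lambda>\<omega>. t * R \<omega>)" using that by simp
    show "AE \<omega> in M. norm (window_integral h t (\<Sigma> \<omega>) * R \<omega>) \<le> norm (t * R \<omega>)"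
      using W t by (auto simp: abs_mult intro!: mult_right_mono)
  qed (use borel_measurable_integrable[OF that] in measurable)
  define E where "E = expectation (\<lambda>\<omega>. h (\<Sigma> \<omega> + t) - h (\<Sigma> \<omega>))"
  have E: "E = - expectation (\<lambda>\<omega>. window_integral h t (\<Sigma> \<omega>) * \<rho> i (X i \<omega>))" if i: "i \<in> I" for i
  proof -
    have ii: "insert i (I - {i}) = I" using i by auto
    have "indep_var borel (X i) borel (\<lambda>\<omega>. \<Sum>j\<in>I - {i}. X j \<omega>)"
      by (rule indep_vars_sum) (use fin ind ii in auto)
    from weak_score_indep_sum[OF sc[OF i] this, of h t] h1 t
    show ?thesis
      by (simp add: E_def \<Sigma>_def sum.remove[OF fin i])
  qed
  define R where "R \<omega> = (\<Sum>i\<in>I. a i * \<rho> i (X i \<omega>))" for \<omega>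
  have sqR: "integrable M (\<lambda>\<omega>. (R \<omega>)\<^sup>2)"
    "expectation (\<lambda>\<omega>. (R \<omega>)\<^sup>2) = (\<Sum>i\<in>I. (a i)\<^sup>2 * expectation (\<lambda>\<omega>. (\<rho> i (X i \<omega>))\<^sup>2))"
  proof -
    have "indep_vars (\<lambda>_. borel) (\<lambda>i \<omega>. a i * \<rho> i (X i \<omega>)) I"
      by (rule indep_vars_compose2[OF ind, where Y = "\<lambda>i x. a i * \<rho> i x"]) (use S(1) in measurable)
    note * = expectation_square_sum_indep[OF fin this]
    show "integrable M (\<lambda>\<omega>. (R \<omega>)\<^sup>2)"
      "expectation (\<lambda>\<omega>. (R \<omega>)\<^sup>2) = (\<Sum>i\<in>I. (a i)\<^sup>2 * expectation (\<lambda>\<omega>. (\<rho> i (X i \<omega>))\<^sup>2))"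
      using * S by (auto simp: R_def power_mult_distrib)
  qed
  have iR: "integrable M R" unfolding R_def using i\<rho> by auto
  have "E = (\<Sum>i\<in>I. a i * E)" using a by (simp add: sum_distrib_right[symmetric])
  also have "\<dots> = (\<Sum>i\<in>I. - expectation (\<lambda>\<omega>. a i * (window_integral h t (\<Sigma> \<omega>) * \<rho> i (X i \<omega>))))"
    using E by (intro sum.cong) auto
  also have "\<dots> = - expectation (\<lambda>\<omega>. \<Sum>i\<in>I. a i * (window_integral h t (\<Sigma> \<omega>) * \<rho> i (X i \<omega>)))"
    using iW[OF i\<rho>] by (simp add: sum_negf)
  also have "(\<lambda>\<omega>. \<Sum>i\<in>I. a i * (window_integral h t (\<Sigma> \<omega>) * \<rho> i (X i \<omega>))) = (\<lambda>\<omega>. window_integral h t (\<Sigma> \<omega>) * R \<omega>)"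
    by (simp add: R_def sum_distrib_left mult.left_commute)
  finally have "\<bar>E\<bar> = \<bar>expectation (\<lambda>\<omega>. window_integral h t (\<Sigma> \<omega>) * R \<omega>)\<bar>" by simp
  also have "\<dots> \<le> expectation (\<lambda>\<omega>. t * \<bar>R \<omega>\<bar>)"
    by (rule order_trans[OF integral_abs_bound integral_mono])
      (use iR iW[OF iR] integrable_abs[OF iW[OF iR]] W in \<open>auto simp: abs_mult intro!: mult_right_mono\<close>)
  also have "\<dots> = t * expectation (\<lambda>\<omega>. \<bar>R \<omega>\<bar>)" by simp
  also have "\<dots> \<le> t * sqrt (expectation (\<lambda>\<omega>. (R \<omega>)\<^sup>2))"
  proof (intro mult_left_mono real_le_rsqrt t)
    have "0 \<le> variance (\<lambda>\<omega>. \<bar>R \<omega>\<bar>)" by (rule variance_positive)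
    also have "\<dots> = expectation (\<lambda>\<omega>. (R \<omega>)\<^sup>2) - (expectation (\<lambda>\<omega>. \<bar>R \<omega>\<bar>))\<^sup>2"
      using variance_eq[of "\<lambda>\<omega>. \<bar>R \<omega>\<bar>"] iR sqR by simp
    finally show "(expectation (\<lambda>\<omega>. \<bar>R \<omega>\<bar>))\<^sup>2 \<le> expectation (\<lambda>\<omega>. (R \<omega>)\<^sup>2)" by simp
  qed
  finally have "\<bar>E\<bar> \<le> t * sqrt (expectation (\<lambda>\<omega>. (R \<omega>)\<^sup>2))" .
  moreover have "E = expectation (\<lambda>\<omega>. h (\<Sigma> \<omega> + t)) - expectation (\<lambda>\<omega>. h (\<Sigma> \<omega>))"
    unfolding E_def by (intro Bochner_Integration.integral_diff ih) measurable
  ultimately show ?thesis by (simp add: sqR \<Sigma>_def)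
qed

section \<open>From weak convergence to total variation\<close>

text \<open>The density of the sum of a \<open>\<mu>\<close>-distributed variable and an independent normal variable of
  standard deviation \<open>\<delta>\<close>.\<close>
definition smoothed_density :: "real \<Rightarrow> real measure \<Rightarrow> real \<Rightarrow> real" where
  "smoothed_density \<delta> \<mu> y = (LINT x|\<mu>. normal_density 0 \<delta> (y - x))"

lemma normal_density_le_at_mean:
  assumes "0 < \<delta>" shows "normal_density 0 \<delta> x \<le> 1 / sqrt (2 * pi * \<delta>\<^sup>2)"
proof -
  have "exp (- x\<^sup>2 / (2 * \<delta>\<^sup>2)) \<le> 1" using assms by simp
  then have "1 / sqrt (2 * pi * \<delta>\<^sup>2) * exp (- x\<^sup>2 / (2 * \<delta>\<^sup>2)) \<le> 1 / sqrt (2 * pi * \<delta>\<^sup>2) * 1"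
    by (intro mult_left_mono) auto
  then show ?thesis by (simp add: normal_density_def)
qed

context real_distribution
begin

lemma borel_measurable_smoothed_density [measurable]: "smoothed_density \<delta> M \<in> borel_measurable borel"
  unfolding smoothed_density_def[abs_def] by measurable

lemma smoothed_density_nonneg: "0 < \<delta> \<Longrightarrow> 0 \<le> smoothed_density \<delta> M y"
  unfolding smoothed_density_def by (intro integral_nonneg_AE) (auto simp: less_imp_le)

lemma integral_smoothed_density:
  fixes h :: "real \<Rightarrow> real"
  assumes \<delta>: "0 < \<delta>" and [measurable]: "h \<in> borel_measurable borel" and h1: "\<And>x. \<bar>h x\<bar> \<le> 1"
  shows "integrable lborel (\<lambda>y. smoothed_density \<delta> M y * h y)"
    and "(LINT y|lborel. smoothed_density \<delta> M y * h y)
      = (LINT t|lborel. normal_density 0 \<delta> t * (LINT x|M. h (x + t)))"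
    and "integrable lborel (\<lambda>t. normal_density 0 \<delta> t * (LINT x|M. h (x + t)))"
proof -
  interpret P: pair_sigma_finite M "lborel :: real measure" ..
  have [simp]: "normal_density 0 \<delta> x \<ge> 0" for x using \<delta> by (simp add: less_imp_le)
  have nh: "norm (normal_density 0 \<delta> t * h y) \<le> normal_density 0 \<delta> t" for t y
    by (auto simp: abs_mult h1 mult_left_le)
  have i1: "integrable lborel (\<lambda>y. normal_density 0 \<delta> (y - x) * k y)"
    if [measurable]: "k \<in> borel_measurable borel" and "\<And>y. \<bar>k y\<bar> \<le> 1" for x and k :: "real \<Rightarrow> real"
  proof (rule Bochner_Integration.integrable_bound)
    show "integrable lborel (\<lambda>y. normal_density 0 \<delta> (y - x))"
      using lborel_integrable_real_affine[OF integrable_normal_density[OF \<delta>], of 1 0 "-x"] by (simp add: add.commute)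
  qed (auto simp: abs_mult that mult_left_le)
  have int_nd: "(LINT y|lborel. normal_density 0 \<delta> (y - x)) = 1" for x
    using lborel_integral_real_affine[of 1 "normal_density 0 \<delta>" "-x"] \<delta> by (simp add: add.commute)
  have p1: "integrable (M \<Otimes>\<^sub>M lborel) (\<lambda>(x, y). normal_density 0 \<delta> (y - x) * h y)"
  proof (rule P.Fubini_integrable)
    show "integrable M (\<lambda>x. LINT y|lborel. norm (case (x, y) of (x, y) \<Rightarrow> normal_density 0 \<delta> (y - x) * h y))"
    proof (rule integrable_const_bound[where B = 1])
      show "AE x in M. norm (LINT y|lborel. norm (case (x, y) of (x, y) \<Rightarrow> normal_density 0 \<delta> (y - x) * h y)) \<le> 1"
      proof (rule AE_I2)
        fix x
        have "(LINT y|lborel. norm (normal_density 0 \<delta> (y - x) * h y)) \<le> (LINT y|lborel. normal_density 0 \<delta> (y - x))"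
          by (intro integral_mono integrable_norm i1 h1 nh) (use i1[of "\<lambda>_. 1" x] in auto)
        then show "norm (LINT y|lborel. norm (case (x, y) of (x, y) \<Rightarrow> normal_density 0 \<delta> (y - x) * h y)) \<le> 1"
          by (simp add: int_nd integral_nonneg_AE abs_of_nonneg)
      qed
    qed measurable
  qed (use i1 h1 in auto)
  have sd: "(LINT x|M. normal_density 0 \<delta> (y - x) * h y) = smoothed_density \<delta> M y * h y" for y
    by (simp add: smoothed_density_def)
  show "integrable lborel (\<lambda>y. smoothed_density \<delta> M y * h y)"
    using P.integrable_snd[OF p1] by (simp add: smoothed_density_def)
  have ih: "integrable M (\<lambda>x. h (x + t))" for t
    by (rule integrable_const_bound[where B = 1]) (auto simp: h1)
  have p2: "integrable (M \<Otimes>\<^sub>M lborel) (\<lambda>(x, t). normal_density 0 \<delta> t * h (x + t))"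
  proof (rule P.Fubini_integrable)
    have i2: "integrable lborel (\<lambda>t. normal_density 0 \<delta> t * h (x + t))" for x
      by (rule Bochner_Integration.integrable_bound[OF integrable_normal_density[OF \<delta>, of 0]])
        (auto simp: abs_mult h1 mult_left_le)
    show "integrable M (\<lambda>x. LINT y|lborel. norm (case (x, y) of (x, t) \<Rightarrow> normal_density 0 \<delta> t * h (x + t)))"
    proof (rule integrable_const_bound[where B = 1])
      show "AE x in M. norm (LINT y|lborel. norm (case (x, y) of (x, t) \<Rightarrow> normal_density 0 \<delta> t * h (x + t))) \<le> 1"
      proof (rule AE_I2)
        fix x
        have "(LINT t|lborel. norm (normal_density 0 \<delta> t * h (x + t))) \<le> (LINT t|lborel. normal_density 0 \<delta> t)"
          by (intro integral_mono integrable_norm i2 nh) (use \<delta> in auto)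
        then show "norm (LINT y|lborel. norm (case (x, y) of (x, t) \<Rightarrow> normal_density 0 \<delta> t * h (x + t))) \<le> 1"
          using \<delta> by (simp add: integral_nonneg_AE abs_of_nonneg)
      qed
    qed measurable
    show "AE x in M. integrable lborel (\<lambda>y. case (x, y) of (x, t) \<Rightarrow> normal_density 0 \<delta> t * h (x + t))"
      using i2 by simp
  qed measurable
  show "integrable lborel (\<lambda>t. normal_density 0 \<delta> t * (LINT x|M. h (x + t)))"
    using P.integrable_snd[OF p2] by simp
  have "(LINT y|lborel. smoothed_density \<delta> M y * h y) = (LINT x|M. LINT y|lborel. normal_density 0 \<delta> (y - x) * h y)"
    using P.Fubini_integral[OF p1] by (simp add: smoothed_density_def)
  also have "\<dots> = (LINT x|M. LINT t|lborel. normal_density 0 \<delta> t * h (x + t))"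
  proof (rule Bochner_Integration.integral_cong[OF refl])
    fix x
    show "(LINT y|lborel. normal_density 0 \<delta> (y - x) * h y) = (LINT t|lborel. normal_density 0 \<delta> t * h (x + t))"
      using lborel_integral_real_affine[of 1 "\<lambda>y. normal_density 0 \<delta> (y - x) * h y" x] by simp
  qed
  also have "\<dots> = (LINT t|lborel. normal_density 0 \<delta> t * (LINT x|M. h (x + t)))"
    using P.Fubini_integral[OF p2] by simp
  finally show "(LINT y|lborel. smoothed_density \<delta> M y * h y)
      = (LINT t|lborel. normal_density 0 \<delta> t * (LINT x|M. h (x + t)))" .
qed

lemma has_integral_smoothed_density:
  assumes "0 < \<delta>"
  shows "integrable lborel (smoothed_density \<delta> M)" "(LINT y|lborel. smoothed_density \<delta> M y) = 1"
  using integral_smoothed_density[OF assms, of "\<lambda>_. 1"] assms prob_space by simp_all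

text \<open>The smoothed law is a mixture of translates of \<open>M\<close>. The translation by \<open>t\<close> costs \<open>K * \<bar>t\<bar>\<close>,
  and a normal variable of standard deviation \<open>\<delta>\<close> has first absolute moment \<open>\<delta> * sqrt (2 / pi)\<close>.\<close>
lemma smoothing_error:
  fixes h :: "real \<Rightarrow> real"
  assumes \<delta>: "0 < \<delta>" and [measurable]: "h \<in> borel_measurable borel" and h1: "\<And>x. \<bar>h x\<bar> \<le> 1"
    and K: "\<And>t. \<bar>(LINT x|M. h (x + t)) - (LINT x|M. h x)\<bar> \<le> K * \<bar>t\<bar>"
  shows "\<bar>(LINT y|lborel. smoothed_density \<delta> M y * h y) - (LINT x|M. h x)\<bar> \<le> K * (\<delta> * sqrt (2 / pi))"
proof -
  note I = integral_smoothed_density[OF \<delta> assms(2) h1]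
  have nd: "integrable lborel (\<lambda>t. normal_density 0 \<delta> t * \<bar>t\<bar>)"
    "(LINT t|lborel. normal_density 0 \<delta> t * \<bar>t\<bar>) = \<delta> * sqrt (2 / pi)"
    using integrable_normal_moment_abs[OF \<delta>, of 0 1] integral_normal_moment_abs_odd[OF \<delta>, of 0 0] by simp_all
  have i: "integrable lborel (\<lambda>t. normal_density 0 \<delta> t * (LINT x|M. h x))"
    using \<delta> by simp
  have "(LINT y|lborel. smoothed_density \<delta> M y * h y) - (LINT x|M. h x)
      = (LINT t|lborel. normal_density 0 \<delta> t * (LINT x|M. h (x + t)))
        - (LINT t|lborel. normal_density 0 \<delta> t * (LINT x|M. h x))"
    using \<delta> I(2) by simp
  also have "\<dots> = (LINT t|lborel. normal_density 0 \<delta> t * ((LINT x|M. h (x + t)) - (LINT x|M. h x)))"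
    using I(3) i by (simp add: right_diff_distrib)
  finally have "\<bar>(LINT y|lborel. smoothed_density \<delta> M y * h y) - (LINT x|M. h x)\<bar>
      = \<bar>LINT t|lborel. normal_density 0 \<delta> t * ((LINT x|M. h (x + t)) - (LINT x|M. h x))\<bar>" by simp
  also have "\<dots> \<le> (LINT t|lborel. K * (normal_density 0 \<delta> t * \<bar>t\<bar>))"
  proof (rule integral_abs_bound_integral)
    show "integrable lborel (\<lambda>t. normal_density 0 \<delta> t * ((LINT x|M. h (x + t)) - (LINT x|M. h x)))"
      using I(3) i by (simp add: right_diff_distrib)
    show "integrable lborel (\<lambda>t. K * (normal_density 0 \<delta> t * \<bar>t\<bar>))" using nd by simp
    fix t
    show "\<bar>normal_density 0 \<delta> t * ((LINT x|M. h (x + t)) - (LINT x|M. h x))\<bar> \<le> K * (normal_density 0 \<delta> t * \<bar>t\<bar>)"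
      using mult_left_mono[OF K[of t], of "normal_density 0 \<delta> t"] \<delta> by (simp add: abs_mult less_imp_le ac_simps)
  qed
  also have "\<dots> = K * (\<delta> * sqrt (2 / pi))" using nd by simp
  finally show ?thesis .
qed

end

text \<open>The value of a smoothed density at a point is the expectation of a bounded continuous function, so
  the densities converge pointwise; as all of them have integral 1, Scheffe's lemma applies.\<close>
lemma smoothed_density_L1_convergence:
  fixes \<mu> :: "nat \<Rightarrow> real measure"
  assumes rd: "\<And>n. real_distribution (\<mu> n)" "real_distribution \<nu>" and wc: "weak_conv_m \<mu> \<nu>" and \<delta>: "0 < \<delta>"
  shows "(\<lambda>n. LINT y|lborel. \<bar>smoothed_density \<delta> (\<mu> n) y - smoothed_density \<delta> \<nu> y\<bar>) \<longlonglongrightarrow> 0"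
proof -
  interpret \<nu>: real_distribution \<nu> by fact
  interpret \<mu>: real_distribution "\<mu> n" for n by fact
  have one: "(\<integral>\<^sup>+y. ennreal \<bar>smoothed_density \<delta> m y\<bar> \<partial>lborel) = 1" if "real_distribution m" for m
  proof -
    interpret real_distribution m by fact
    show ?thesis
      using has_integral_smoothed_density[OF \<delta>] smoothed_density_nonneg[OF \<delta>]
      by (simp add: nn_integral_eq_integral)
  qed
  have "(\<lambda>n. \<integral>\<^sup>+y. norm (smoothed_density \<delta> (\<mu> n) y - smoothed_density \<delta> \<nu> y) \<partial>lborel) \<longlonglongrightarrow> 0"
  proof (rule Scheffe_lemma2)
    show "AE y in lborel. (\<lambda>n. smoothed_density \<delta> (\<mu> n) y) \<longlonglongrightarrow> smoothed_density \<delta> \<nu> y"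
    proof (rule AE_I2)
      fix y :: real
      show "(\<lambda>n. smoothed_density \<delta> (\<mu> n) y) \<longlonglongrightarrow> smoothed_density \<delta> \<nu> y"
        unfolding smoothed_density_def
        by (rule weak_conv_imp_integral_bdd_continuous_conv[OF rd wc, where B = "1 / sqrt (2 * pi * \<delta>\<^sup>2)"])
          (use normal_density_le_at_mean[OF \<delta>] \<delta> in \<open>auto simp: normal_density_def[abs_def] abs_of_nonneg less_imp_le intro!: continuous_intros\<close>)
    qed
  qed (auto simp: one rd \<nu>.has_integral_smoothed_density[OF \<delta>])
  then have "(\<lambda>n. ennreal (LINT y|lborel. \<bar>smoothed_density \<delta> (\<mu> n) y - smoothed_density \<delta> \<nu> y\<bar>)) \<longlonglongrightarrow> ennreal 0"
    using \<nu>.has_integral_smoothed_density[OF \<delta>] \<mu>.has_integral_smoothed_density[OF \<delta>]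
    by (subst (asm) nn_integral_eq_integral) auto
  then show ?thesis
    by (subst (asm) tendsto_ennreal_iff) (auto intro!: integral_nonneg_AE)
qed

text \<open>A common modulus of translation makes smoothing uniformly cheap, and the smoothed laws converge in
  \<open>L\<^sup>1\<close>. Without the modulus this fails: discrete laws may converge weakly to a continuous one.\<close>
lemma weak_conv_imp_uniform_conv_bounded_measurable:
  fixes \<mu> :: "nat \<Rightarrow> real measure"
  assumes rd: "\<And>n. real_distribution (\<mu> n)" "real_distribution \<nu>" and wc: "weak_conv_m \<mu> \<nu>"
    and K\<mu>: "\<And>n h t. n \<ge> start \<Longrightarrow> h \<in> borel_measurable borel \<Longrightarrow> (\<And>x. \<bar>h x\<bar> \<le> 1) \<Longrightarrow>
        \<bar>(LINT x|\<mu> n. h (x + t)) - (LINT x|\<mu> n. h x)\<bar> \<le> K * \<bar>t\<bar>"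
    and K\<nu>: "\<And>h t. h \<in> borel_measurable borel \<Longrightarrow> (\<And>x. \<bar>h x\<bar> \<le> 1) \<Longrightarrow>
        \<bar>(LINT x|\<nu>. h (x + t)) - (LINT x|\<nu>. h x)\<bar> \<le> K * \<bar>t\<bar>"
    and \<epsilon>: "0 < \<epsilon>"
  shows "\<forall>\<^sub>F n in sequentially. \<forall>h. h \<in> borel_measurable borel \<longrightarrow> (\<forall>x::real. \<bar>h x :: real\<bar> \<le> 1) \<longrightarrow>
    \<bar>(LINT x|\<mu> n. h x) - (LINT x|\<nu>. h x)\<bar> < \<epsilon>"
proof -
  interpret \<nu>: real_distribution \<nu> by fact
  interpret \<mu>: real_distribution "\<mu> n" for n by fact
  have K0: "0 \<le> K" using K\<nu>[of "\<lambda>_. 0" 1] by simp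
  \<comment> \<open>One third of \<open>\<epsilon>\<close> for smoothing each of the two laws, one third for the smoothed densities.\<close>
  define \<delta> where "\<delta> = \<epsilon> / (3 * (K + 1))"
  have \<delta>: "0 < \<delta>" using K0 \<epsilon> by (simp add: \<delta>_def)
  have "sqrt (2 / pi) \<le> 1" using pi_ge_two by simp
  then have "K * (\<delta> * sqrt (2 / pi)) \<le> K * (\<delta> * 1)" using K0 \<delta> by (intro mult_left_mono) auto
  also have "K * (\<delta> * 1) < \<epsilon> / 3" using K0 \<epsilon> by (simp add: \<delta>_def field_simps)
  finally have K\<delta>: "K * (\<delta> * sqrt (2 / pi)) < \<epsilon> / 3" .
  have "\<forall>\<^sub>F n in sequentially. (LINT y|lborel. \<bar>smoothed_density \<delta> (\<mu> n) y - smoothed_density \<delta> \<nu> y\<bar>) < \<epsilon> / 3"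
    using order_tendstoD(2)[OF smoothed_density_L1_convergence[OF rd wc \<delta>], of "\<epsilon> / 3"] \<epsilon> by simp
  then show ?thesis
    using eventually_ge_at_top[of start]
  proof eventually_elim
    case (elim n)
    show ?case
    proof (intro allI impI)
      fix h :: "real \<Rightarrow> real"
      assume [measurable]: "h \<in> borel_measurable borel" and h1: "\<forall>x. \<bar>h x\<bar> \<le> 1"
      then have h1: "\<bar>h x\<bar> \<le> 1" for x by simp
      note i\<mu> = \<mu>.integral_smoothed_density(1)[OF \<delta> \<open>h \<in> borel_measurable borel\<close> h1, of n]
      note i\<nu> = \<nu>.integral_smoothed_density(1)[OF \<delta> \<open>h \<in> borel_measurable borel\<close> h1]
      have "\<bar>(LINT y|lborel. smoothed_density \<delta> (\<mu> n) y * h y) - (LINT y|lborel. smoothed_density \<delta> \<nu> y * h y)\<bar>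
          = \<bar>LINT y|lborel. (smoothed_density \<delta> (\<mu> n) y - smoothed_density \<delta> \<nu> y) * h y\<bar>"
        using i\<mu> i\<nu> by (simp add: left_diff_distrib)
      also have "\<dots> \<le> (LINT y|lborel. \<bar>smoothed_density \<delta> (\<mu> n) y - smoothed_density \<delta> \<nu> y\<bar>)"
        by (rule integral_abs_bound_integral)
          (use i\<mu> i\<nu> \<mu>.has_integral_smoothed_density(1)[OF \<delta>] \<nu>.has_integral_smoothed_density(1)[OF \<delta>] h1
           in \<open>auto simp: left_diff_distrib\<close>, auto simp: left_diff_distrib[symmetric] abs_mult intro: mult_left_le h1)
      finally have "\<bar>(LINT y|lborel. smoothed_density \<delta> (\<mu> n) y * h y) - (LINT y|lborel. smoothed_density \<delta> \<nu> y * h y)\<bar> < \<epsilon> / 3"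
        using elim by simp
      moreover have "\<bar>(LINT y|lborel. smoothed_density \<delta> (\<mu> n) y * h y) - (LINT x|\<mu> n. h x)\<bar> < \<epsilon> / 3"
        using order.strict_trans1[OF \<mu>.smoothing_error[where h = h and K = K and n = n, OF \<delta> _ h1 K\<mu>] K\<delta>] elim h1 by simp
      moreover have "\<bar>(LINT y|lborel. smoothed_density \<delta> \<nu> y * h y) - (LINT x|\<nu>. h x)\<bar> < \<epsilon> / 3"
        using order.strict_trans1[OF \<nu>.smoothing_error[where h = h and K = K, OF \<delta> _ h1 K\<nu>] K\<delta>] h1 by simp
      ultimately show "\<bar>(LINT x|\<mu> n. h x) - (LINT x|\<nu>. h x)\<bar> < \<epsilon>" by linarith
    qed
  qed
qed

lemma translation_bound_signed:
  assumes pos: "\<And>h t. h \<in> borel_measurable borel \<Longrightarrow> (\<And>x. \<bar>h x\<bar> \<le> 1) \<Longrightarrow> 0 \<le> t \<Longrightarrow>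
      \<bar>(LINT x|\<mu>. h (x + t)) - (LINT x|\<mu>. h x)\<bar> \<le> K * t"
    and [measurable]: "h \<in> borel_measurable borel" and h1: "\<And>x. \<bar>h x\<bar> \<le> (1::real)"
  shows "\<bar>(LINT x|\<mu>. h (x + t)) - (LINT x|\<mu>. h x)\<bar> \<le> K * \<bar>t::real\<bar>"
proof (cases "0 \<le> t")
  case True
  then show ?thesis using pos[of h t] h1 by simp
next
  case False
  have "\<bar>(LINT x|\<mu>. h (x + - t + t)) - (LINT x|\<mu>. h (x + t))\<bar> \<le> K * - t"
    using False by (intro pos[of "\<lambda>x. h (x + t)" "- t"] h1) auto
  with False show ?thesis by (simp add: abs_minus_commute)
qed

lemma d_TV_bound:
  fixes U :: "'a \<Rightarrow> real" and V :: "'b \<Rightarrow> real"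
  assumes "prob_space M" "prob_space M'" 
    and [measurable]: "U \<in> borel_measurable M" "V \<in> borel_measurable M'"
    and h: "h \<in> borel_measurable borel" "\<And>x. \<bar>h x\<bar> \<le> 1"
  shows "\<bar>prob_space.expectation M (\<lambda>\<omega>. h (U \<omega>)) - prob_space.expectation M' (\<lambda>\<omega>. h (V \<omega>))\<bar> \<le> 2 * d_TV M U M' V"
proof -
  interpret M: prob_space M by fact
  interpret M': prob_space M' by fact
  let ?H = "{h :: real \<Rightarrow> real. h \<in> borel_measurable borel \<and> (\<forall>x. \<bar>h x\<bar> \<le> 1)}"
  let ?f = "\<lambda>h. \<bar>M.expectation (\<lambda>\<omega>. h (U \<omega>)) - M'.expectation (\<lambda>\<omega>. h (V \<omega>))\<bar>"
  have "?f g \<le> 2" if "g \<in> ?H" for g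
  proof -
    have [measurable]: "g \<in> borel_measurable borel" and g1: "\<And>x. \<bar>g x\<bar> \<le> 1" using that by auto
    have "\<bar>M.expectation (\<lambda>\<omega>. g (U \<omega>))\<bar> \<le> M.expectation (\<lambda>\<omega>. 1)"
      by (rule order_trans[OF integral_abs_bound integral_mono_AE']) (auto simp: g1)
    moreover have "\<bar>M'.expectation (\<lambda>\<omega>. g (V \<omega>))\<bar> \<le> M'.expectation (\<lambda>\<omega>. 1)"
      by (rule order_trans[OF integral_abs_bound integral_mono_AE']) (auto simp: g1)
    ultimately show ?thesis by (simp add: M.prob_space M'.prob_space)
  qed
  then have "bdd_above (?f ` ?H)" by (intro bdd_aboveI2)
  then have "?f h \<le> (SUP h\<in>?H. ?f h)" using h by (intro cSUP_upper) auto
  then show ?thesis by (simp add: d_TV_def)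
qed

lemma d_TV_le:
  assumes "\<And>h. h \<in> borel_measurable borel \<Longrightarrow> (\<And>x. \<bar>h x\<bar> \<le> 1) \<Longrightarrow>
    \<bar>prob_space.expectation M (\<lambda>\<omega>. h (U \<omega>)) - prob_space.expectation M' (\<lambda>\<omega>. h (V \<omega>))\<bar> \<le> c"
  shows "d_TV M U M' V \<le> c / 2"
proof -
  have "(SUP h\<in>{h :: real \<Rightarrow> real. h \<in> borel_measurable borel \<and> (\<forall>x. \<bar>h x\<bar> \<le> 1)}.
      \<bar>prob_space.expectation M (\<lambda>\<omega>. h (U \<omega>)) - prob_space.expectation M' (\<lambda>\<omega>. h (V \<omega>))\<bar>) \<le> c"
  proof (rule cSUP_least)
    have "(\<lambda>_. 0) \<in> {h :: real \<Rightarrow> real. h \<in> borel_measurable borel \<and> (\<forall>x. \<bar>h x\<bar> \<le> 1)}" by simp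
    then show "{h :: real \<Rightarrow> real. h \<in> borel_measurable borel \<and> (\<forall>x. \<bar>h x\<bar> \<le> 1)} \<noteq> {}" by blast
  qed (use assms in auto)
  then show ?thesis by (simp add: d_TV_def)
qed

text \<open>Real and imaginary part are expectations of test functions, each costing \<open>2 * d_TV\<close>.\<close>
lemma norm_char_diff_le_d_TV:
  assumes "prob_space M" "prob_space M'" 
    and [measurable]: "U \<in> borel_measurable M" "V \<in> borel_measurable M'"
  shows "norm (char (distr M borel U) t - char (distr M' borel V) t) \<le> 4 * d_TV M U M' V"
proof -
  have char_eq: "Re (char (distr L borel Y) t) = prob_space.expectation L (\<lambda>\<omega>. cos (t * Y \<omega>))"
    "Im (char (distr L borel Y) t) = prob_space.expectation L (\<lambda>\<omega>. sin (t * Y \<omega>))"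
    if "prob_space L" and [measurable]: "Y \<in> borel_measurable L" for L :: "'c measure" and Y
  proof -
    interpret L: prob_space L by fact
    have ie: "integrable L (\<lambda>\<omega>. iexp (t * Y \<omega>))"
      by (rule L.integrable_const_bound[where B = 1]) auto
    have "char (distr L borel Y) t = (CLINT \<omega>|L. iexp (t * Y \<omega>))"
      unfolding char_def by (rule integral_distr) measurable
    then show "Re (char (distr L borel Y) t) = L.expectation (\<lambda>\<omega>. cos (t * Y \<omega>))"
      "Im (char (distr L borel Y) t) = L.expectation (\<lambda>\<omega>. sin (t * Y \<omega>))"
      using integral_Re[OF ie] integral_Im[OF ie] by (simp_all add: Re_exp Im_exp)
  qed
  let ?z = "char (distr M borel U) t - char (distr M' borel V) t"
  note B = d_TV_bound[OF assms]
  have "\<bar>Re ?z\<bar> \<le> 2 * d_TV M U M' V"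
    using B[of "\<lambda>x. cos (t * x)"] by (simp add: char_eq assms)
  moreover have "\<bar>Im ?z\<bar> \<le> 2 * d_TV M U M' V"
    using B[of "\<lambda>x. sin (t * x)"] by (simp add: char_eq assms)
  ultimately show ?thesis using cmod_le[of ?z] by linarith
qed

section \<open>The Lindeberg-Feller theorem\<close>

text \<open>The constant is \<open>exp 2\<close> because \<open>\<bar>Re (z - 1)\<bar> \<le> 2\<close> on the unit disc.\<close>
lemma norm_diff_exp_le:
  fixes z :: complex
  assumes "norm z \<le> 1"
  shows "norm (z - exp (z - 1)) \<le> exp 2 * (norm (z - 1))\<^sup>2"
proof -
  have "norm (exp (z - 1) - (\<Sum>i\<le>1. (z - 1) ^ i / fact i)) \<le> exp \<bar>Re (z - 1)\<bar> * norm (z - 1) ^ Suc 1 / fact 1"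
    by (rule Taylor_exp)
  moreover have "\<bar>Re (z - 1)\<bar> \<le> 2"
    using abs_Re_le_cmod[of z] assms by (simp add: abs_le_iff)
  then have "exp \<bar>Re (z - 1)\<bar> * (norm (z - 1))\<^sup>2 \<le> exp 2 * (norm (z - 1))\<^sup>2"
    by (intro mult_right_mono) auto
  ultimately show ?thesis
    by (simp add: norm_minus_commute power2_eq_square)
qed

text \<open>The factors \<open>exp (z i - 1)\<close> also lie in the unit disc, as \<open>Re (z i) \<le> 1\<close>, so the products differ by
  at most the sum of the differences of their factors.\<close>
lemma norm_prod_diff_exp_sum_le:
  fixes z :: "'i \<Rightarrow> complex"
  assumes "finite I" "\<And>i. i \<in> I \<Longrightarrow> norm (z i) \<le> 1"
  shows "norm ((\<Prod>i\<in>I. z i) - exp (\<Sum>i\<in>I. z i - 1)) \<le> exp 2 * (\<Sum>i\<in>I. (norm (z i - 1))\<^sup>2)"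
proof -
  have "norm ((\<Prod>i\<in>I. z i) - (\<Prod>i\<in>I. exp (z i - 1))) \<le> (\<Sum>i\<in>I. norm (z i - exp (z i - 1)))"
  proof (rule norm_prod_diff)
    fix i assume "i \<in> I"
    then have "norm (z i) \<le> 1" by (rule assms)
    then show "norm (z i) \<le> 1" "norm (exp (z i - 1)) \<le> 1"
      using complex_Re_le_cmod[of "z i"] by auto
  qed
  also have "\<dots> \<le> (\<Sum>i\<in>I. exp 2 * (norm (z i - 1))\<^sup>2)"
    by (intro sum_mono norm_diff_exp_le assms)
  finally show ?thesis using assms(1) by (simp add: exp_sum sum_distrib_left)
qed

lemma cos_ge_quadratic: "0 \<le> cos x - 1 + x\<^sup>2 / 2" for x :: real
proof -
  have "\<bar>sin (x / 2)\<bar> \<le> \<bar>x / 2\<bar>" by (rule abs_sin_x_le_abs_x)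
  then have "(sin (x / 2))\<^sup>2 \<le> (x / 2)\<^sup>2" by (simp only: abs_le_square_iff)
  then show ?thesis using cos_double_sin[of "x / 2"] by (simp add: power_divide)
qed

text \<open>Where \<open>\<bar>x\<bar>\<close> exceeds \<open>\<epsilon>\<close>, the part \<open>2 * x\<^sup>2 / \<epsilon>\<^sup>2\<close> of \<open>(t * x)\<^sup>2 / 2\<close> compensates for
  \<open>cos (t * x) - 1 \<ge> - 2\<close>, and \<open>x\<^sup>2\<close> is left over. This fixes the choice of \<open>t\<close>.\<close>
lemma cos_remainder_ge_square:
  fixes x \<epsilon> :: real
  assumes "0 < \<epsilon>" "\<epsilon> < \<bar>x\<bar>" and t: "t\<^sup>2 = 4 / \<epsilon>\<^sup>2 + 2"
  shows "x\<^sup>2 \<le> cos (t * x) - 1 + (t * x)\<^sup>2 / 2"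
proof -
  have "\<epsilon>\<^sup>2 \<le> x\<^sup>2" using assms by (simp add: abs_le_square_iff[symmetric])
  then have "2 \<le> 2 / \<epsilon>\<^sup>2 * x\<^sup>2" using assms(1) by (simp add: field_simps)
  moreover have "(t * x)\<^sup>2 / 2 = 2 / \<epsilon>\<^sup>2 * x\<^sup>2 + x\<^sup>2"
    by (simp add: power_mult_distrib t algebra_simps)
  ultimately show ?thesis using cos_ge_minus_one[of "t * x"] by linarith
qed

locale centered_indep_sequence = prob_space M for M :: "'a measure" +
  fixes X :: "nat \<Rightarrow> 'a \<Rightarrow> real"
  assumes indep: "indep_vars (\<lambda>_. borel) X {1..}"
    and square_integrable: "\<And>k. k \<ge> 1 \<Longrightarrow> integrable M (\<lambda>\<omega>. (X k \<omega>)\<^sup>2)"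
    and centered: "\<And>k. k \<ge> 1 \<Longrightarrow> expectation (X k) = 0"
    and second_moment_pos: "\<And>k. k \<ge> 1 \<Longrightarrow> expectation (\<lambda>\<omega>. (X k \<omega>)\<^sup>2) > 0"
begin

definition second_moment :: "nat \<Rightarrow> real" where
  "second_moment k = expectation (\<lambda>\<omega>. (X k \<omega>)\<^sup>2)"

definition sum_sd :: "nat \<Rightarrow> real" where
  "sum_sd n = sqrt (\<Sum>k=1..n. second_moment k)"

definition normalized_sum :: "nat \<Rightarrow> 'a \<Rightarrow> real" where
  "normalized_sum n \<omega> = (\<Sum>k=1..n. X k \<omega>) / sum_sd n"

definition lindeberg_term :: "real \<Rightarrow> nat \<Rightarrow> nat \<Rightarrow> real" where
  "lindeberg_term \<epsilon> n k =
     expectation (\<lambda>\<omega>. (X k \<omega>)\<^sup>2 * indicator {\<omega> \<in> space M. \<bar>X k \<omega>\<bar> > \<epsilon> * sum_sd n} \<omega>)"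

definition lindeberg :: bool where
  "lindeberg \<longleftrightarrow> (\<forall>\<epsilon>>0. (\<lambda>n. 1 / (sum_sd n)\<^sup>2 * (\<Sum>k=1..n. lindeberg_term \<epsilon> n k)) \<longlonglongrightarrow> 0)"

definition feller_levy :: bool where
  "feller_levy \<longleftrightarrow> (\<lambda>n. MAX k\<in>{1..n}. second_moment k / (sum_sd n)\<^sup>2) \<longlonglongrightarrow> 0"

lemma rv [measurable]: "k \<ge> 1 \<Longrightarrow> random_variable borel (X k)"
  using indep by (auto simp: indep_vars_def)

lemma integrable_X: "k \<ge> 1 \<Longrightarrow> integrable M (X k)"
  using square_integrable_imp_integrable[of "X k"] square_integrable[of k] rv[of k] by simp

lemma second_moment_pos': "k \<ge> 1 \<Longrightarrow> second_moment k > 0"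
  using second_moment_pos by (simp add: second_moment_def)

lemma sum_sd_square: "(sum_sd n)\<^sup>2 = (\<Sum>k=1..n. second_moment k)"
proof -
  have "0 \<le> (\<Sum>k=1..n. second_moment k)"
    by (rule sum_nonneg) (simp add: second_moment_def)
  then show ?thesis unfolding sum_sd_def by (rule real_sqrt_pow2)
qed

lemma sum_sd_pos:
  assumes "n \<ge> 1"
  shows "sum_sd n > 0"
  unfolding sum_sd_def using assms by (intro real_sqrt_gt_zero sum_pos) (auto intro: second_moment_pos')

lemma measurable_normalized_sum [measurable]: "random_variable borel (normalized_sum n)"
  unfolding normalized_sum_def[abs_def] by (intro borel_measurable_divide borel_measurable_sum rv) auto

lemma char_normalized_sum:
  "char (distr M borel (normalized_sum n)) t = (\<Prod>k=1..n. char (distr M borel (X k)) (t / sum_sd n))"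
proof -
  have [measurable]: "random_variable borel (\<lambda>\<omega>. \<Sum>k=1..n. X k \<omega>)"
    by (intro borel_measurable_sum rv) auto
  have "char (distr M borel (normalized_sum n)) t = char (distr M borel (\<lambda>\<omega>. \<Sum>k=1..n. X k \<omega>)) (t / sum_sd n)"
    by (simp add: char_def integral_distr normalized_sum_def)
  also have "\<dots> = (\<Prod>k=1..n. char (distr M borel (X k)) (t / sum_sd n))"
    by (intro char_distr_sum indep_vars_subset[OF indep]) auto
  finally show ?thesis .
qed

lemma variance_X: "k \<ge> 1 \<Longrightarrow> variance (X k) = second_moment k"
  by (simp add: centered second_moment_def)

lemma char_second_order:
  assumes "k \<ge> 1"
  shows "norm (char (distr M borel (X k)) s - (1 - s\<^sup>2 * second_moment k / 2))
    \<le> s\<^sup>2 / 6 * expectation (\<lambda>\<omega>. min (6 * (X k \<omega>)\<^sup>2) (\<bar>s\<bar> * \<bar>X k \<omega>\<bar> ^ 3))"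
  using char_approx3'[OF rv[OF assms] integrable_X[OF assms] square_integrable[OF assms]
      centered[OF assms] variance_X[OF assms] refl, of s]
  by simp

lemma integrable_min_remainder:
  assumes "k \<ge> 1"
  shows "integrable M (\<lambda>\<omega>. min (6 * (X k \<omega>)\<^sup>2) (\<bar>s\<bar> * \<bar>X k \<omega>\<bar> ^ 3))"
  by (rule Bochner_Integration.integrable_bound[of _ "\<lambda>\<omega>. 6 * (X k \<omega>)\<^sup>2"])
    (use square_integrable[OF assms] rv[OF assms] in auto)

lemma norm_char_minus_one_le:
  assumes k: "k \<ge> 1"
  shows "norm (char (distr M borel (X k)) s - 1) \<le> 3 / 2 * s\<^sup>2 * second_moment k"
proof -
  have "expectation (\<lambda>\<omega>. min (6 * (X k \<omega>)\<^sup>2) (\<bar>s\<bar> * \<bar>X k \<omega>\<bar> ^ 3)) \<le> expectation (\<lambda>\<omega>. 6 * (X k \<omega>)\<^sup>2)"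
    using integrable_min_remainder[OF k] square_integrable[OF k] by (intro integral_mono) auto
  then have "s\<^sup>2 / 6 * expectation (\<lambda>\<omega>. min (6 * (X k \<omega>)\<^sup>2) (\<bar>s\<bar> * \<bar>X k \<omega>\<bar> ^ 3)) \<le> s\<^sup>2 / 6 * (6 * second_moment k)"
    by (intro mult_left_mono) (auto simp: second_moment_def)
  with char_second_order[OF k, of s]
  have 1: "norm (char (distr M borel (X k)) s - (1 - s\<^sup>2 * second_moment k / 2)) \<le> s\<^sup>2 * second_moment k"
    by simp
  have "norm (char (distr M borel (X k)) s - 1)
      \<le> norm (char (distr M borel (X k)) s - (1 - s\<^sup>2 * second_moment k / 2)) + norm (complex_of_real (s\<^sup>2 * second_moment k / 2))"
    using norm_triangle_ineq4[of "char (distr M borel (X k)) s - (1 - s\<^sup>2 * second_moment k / 2)" "complex_of_real (s\<^sup>2 * second_moment k / 2)"]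
    by simp
  also have "norm (complex_of_real (s\<^sup>2 * second_moment k / 2)) = s\<^sup>2 * second_moment k / 2"
    using second_moment_pos'[OF k] by (simp only: norm_of_real) simp
  finally show ?thesis using 1 by simp
qed

text \<open>As \<open>\<bar>\<phi>\<^sub>k - 1\<bar>\<close> is at most a multiple of the variance ratio \<open>\<sigma>\<^sub>k\<^sup>2 / b\<^sub>n\<^sup>2\<close> and these ratios sum to 1, the sum of
  the squares is at most a multiple of the largest ratio.\<close>
lemma char_normalized_sum_approx_exp:
  assumes feller_levy
  shows "(\<lambda>n. char (distr M borel (normalized_sum n)) t
    - exp (\<Sum>k=1..n. char (distr M borel (X k)) (t / sum_sd n) - 1)) \<longlonglongrightarrow> 0"
proof (rule Lim_null_comparison)
  let ?r = "\<lambda>n. MAX k\<in>{1..n}. second_moment k / (sum_sd n)\<^sup>2"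
  show "(\<lambda>n. exp 2 * ((3 / 2)\<^sup>2 * t ^ 4 * ?r n)) \<longlonglongrightarrow> 0"
    using assms unfolding feller_levy_def by (intro tendsto_mult_right_zero)
  show "\<forall>\<^sub>F n in sequentially. norm (char (distr M borel (normalized_sum n)) t
    - exp (\<Sum>k=1..n. char (distr M borel (X k)) (t / sum_sd n) - 1)) \<le> exp 2 * ((3 / 2)\<^sup>2 * t ^ 4 * ?r n)"
    using eventually_ge_at_top[of 1]
  proof eventually_elim
    case (elim n)
    let ?z = "\<lambda>k. char (distr M borel (X k)) (t / sum_sd n)"
    have b: "sum_sd n > 0" using elim by (rule sum_sd_pos)
    have z1: "norm (?z k) \<le> 1" if "k \<in> {1..n}" for k
      using that by (intro real_distribution.cmod_char_le_1 real_distribution_distr rv) auto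
    have "(\<Sum>k=1..n. (norm (?z k - 1))\<^sup>2) \<le> (\<Sum>k=1..n. (3 / 2)\<^sup>2 * t ^ 4 * ?r n * (second_moment k / (sum_sd n)\<^sup>2))"
    proof (rule sum_mono)
      fix k assume k: "k \<in> {1..n}"
      define a where "a = second_moment k / (sum_sd n)\<^sup>2"
      have a0: "a \<ge> 0" using second_moment_pos'[of k] k by (simp add: a_def less_imp_le)
      have ar: "a \<le> ?r n" unfolding a_def using k by (intro Max_ge) auto
      have "norm (?z k - 1) \<le> 3 / 2 * t\<^sup>2 * a"
        using norm_char_minus_one_le[of k "t / sum_sd n"] k by (simp add: a_def power_divide)
      then have "(norm (?z k - 1))\<^sup>2 \<le> (3 / 2 * t\<^sup>2 * a)\<^sup>2" by (intro power_mono) auto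
      also have "\<dots> = (3 / 2)\<^sup>2 * t ^ 4 * (a * a)" by (simp add: power_mult_distrib power2_eq_square power4_eq_xxxx)
      also have "\<dots> \<le> (3 / 2)\<^sup>2 * t ^ 4 * (?r n * a)" using a0 ar by (intro mult_left_mono mult_right_mono) auto
      finally show "(norm (?z k - 1))\<^sup>2 \<le> (3 / 2)\<^sup>2 * t ^ 4 * ?r n * (second_moment k / (sum_sd n)\<^sup>2)"
        by (simp add: a_def)
    qed
    also have "\<dots> = (3 / 2)\<^sup>2 * t ^ 4 * ?r n"
      using b by (simp add: sum_distrib_left[symmetric] sum_divide_distrib[symmetric] sum_sd_square[symmetric] del: One_nat_def)
    finally have "exp 2 * (\<Sum>k=1..n. (norm (?z k - 1))\<^sup>2) \<le> exp 2 * ((3 / 2)\<^sup>2 * t ^ 4 * ?r n)"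
      by (intro mult_left_mono) auto
    moreover have "norm ((\<Prod>k=1..n. ?z k) - exp (\<Sum>k=1..n. ?z k - 1)) \<le> exp 2 * (\<Sum>k=1..n. (norm (?z k - 1))\<^sup>2)"
      by (rule norm_prod_diff_exp_sum_le[OF finite_atLeastAtMost z1])
    ultimately show ?case
      unfolding char_normalized_sum by (rule order_trans[rotated])
  qed
qed

lemma integrable_lindeberg_term:
  assumes "k \<ge> 1"
  shows "integrable M (\<lambda>\<omega>. (X k \<omega>)\<^sup>2 * indicator {\<omega> \<in> space M. \<bar>X k \<omega>\<bar> > c} \<omega>)"
  using assms by (intro integrable_real_mult_indicator square_integrable) measurable

text \<open>Splitting at \<open>\<bar>X\<^sub>k\<bar> = \<epsilon> b\<^sub>n\<close> bounds each ratio \<open>\<sigma>\<^sub>k\<^sup>2 / b\<^sub>n\<^sup>2\<close> by \<open>\<epsilon>\<^sup>2\<close> plus the Lindeberg sum.\<close>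
lemma lindeberg_imp_feller_levy:
  assumes lindeberg
  shows feller_levy
  unfolding feller_levy_def
proof (rule LIMSEQ_I)
  fix r :: real assume r: "0 < r"
  define \<epsilon> where "\<epsilon> = sqrt (r / 2)"
  have \<epsilon>: "\<epsilon> > 0" "\<epsilon>\<^sup>2 = r / 2" using r by (simp_all add: \<epsilon>_def)
  have "\<forall>\<^sub>F n in sequentially. 1 / (sum_sd n)\<^sup>2 * (\<Sum>k=1..n. lindeberg_term \<epsilon> n k) < r / 2"
    using assms \<epsilon>(1) r unfolding lindeberg_def by (intro order_tendstoD(2)[of _ 0]) auto
  then have "\<forall>\<^sub>F n in sequentially. norm ((MAX k\<in>{1..n}. second_moment k / (sum_sd n)\<^sup>2) - 0) < r"
    using eventually_ge_at_top[of 1]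
  proof eventually_elim
    case (elim n)
    have b: "sum_sd n > 0" using elim by (intro sum_sd_pos) auto
    have l0: "0 \<le> lindeberg_term \<epsilon> n k" for k
      unfolding lindeberg_term_def by (intro integral_nonneg_AE) auto
    have le: "second_moment k / (sum_sd n)\<^sup>2 < r" if k: "k \<in> {1..n}" for k
    proof -
      have "second_moment k \<le> expectation (\<lambda>\<omega>. (\<epsilon> * sum_sd n)\<^sup>2
          + (X k \<omega>)\<^sup>2 * indicator {\<omega> \<in> space M. \<bar>X k \<omega>\<bar> > \<epsilon> * sum_sd n} \<omega>)"
        unfolding second_moment_def
      proof (rule integral_mono)
        fix \<omega> assume "\<omega> \<in> space M"
        then show "(X k \<omega>)\<^sup>2 \<le> (\<epsilon> * sum_sd n)\<^sup>2 + (X k \<omega>)\<^sup>2 * indicator {\<omega> \<in> space M. \<bar>X k \<omega>\<bar> > \<epsilon> * sum_sd n} \<omega>"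
          using \<epsilon>(1) b by (auto split: split_indicator simp: abs_le_square_iff[symmetric] not_less)
      qed (use k square_integrable[of k] integrable_lindeberg_term[of k] in auto)
      also have "\<dots> = (\<epsilon> * sum_sd n)\<^sup>2 + lindeberg_term \<epsilon> n k"
        using k integrable_lindeberg_term[of k "\<epsilon> * sum_sd n"] by (simp add: lindeberg_term_def prob_space)
      also have "\<dots> \<le> (\<epsilon> * sum_sd n)\<^sup>2 + (\<Sum>k=1..n. lindeberg_term \<epsilon> n k)"
        using k l0 by (intro add_left_mono member_le_sum) auto
      finally have "second_moment k / (sum_sd n)\<^sup>2 \<le> ((\<epsilon> * sum_sd n)\<^sup>2 + (\<Sum>k=1..n. lindeberg_term \<epsilon> n k)) / (sum_sd n)\<^sup>2"
        by (intro divide_right_mono) auto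
      also have "\<dots> = r / 2 + 1 / (sum_sd n)\<^sup>2 * (\<Sum>k=1..n. lindeberg_term \<epsilon> n k)"
        using b by (simp add: add_divide_distrib power_mult_distrib \<epsilon>)
      finally show ?thesis using elim by linarith
    qed
    have ge: "0 \<le> (MAX k\<in>{1..n}. second_moment k / (sum_sd n)\<^sup>2)"
      using elim second_moment_pos'[of 1]
      by (intro Max_ge_iff[THEN iffD2]) (auto intro!: bexI[of _ 1] divide_nonneg_nonneg less_imp_le[OF second_moment_pos'])
    have "(MAX k\<in>{1..n}. second_moment k / (sum_sd n)\<^sup>2) < r"
      using elim le by (subst Max_less_iff) auto
    with ge show ?case by simp
  qed
  then show "\<exists>no. \<forall>n\<ge>no. norm ((MAX k\<in>{1..n}. second_moment k / (sum_sd n)\<^sup>2) - 0) < r"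
    by (simp only: eventually_sequentially)
qed

text \<open>The second-order Taylor remainder of \<open>\<phi>\<^sub>k\<close> is estimated by the quadratic bound where
  \<open>\<bar>X\<^sub>k\<bar> > \<epsilon> b\<^sub>n\<close>, which gives the Lindeberg sum, and by the cubic bound elsewhere, which gives
  a multiple of \<open>\<epsilon>\<close>.\<close>
lemma lindeberg_imp_sum_char_limit:
  assumes lindeberg
  shows "(\<lambda>n. \<Sum>k=1..n. char (distr M borel (X k)) (t / sum_sd n) - 1) \<longlonglongrightarrow> of_real (- t\<^sup>2 / 2)"
proof (rule LIMSEQ_I)
  fix r :: real assume r: "0 < r"
  define \<epsilon> where "\<epsilon> = r / (\<bar>t\<bar> ^ 3 + 1)"
  have "\<bar>t\<bar> ^ 3 + 1 > 0" by (simp add: add_nonneg_pos)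
  then have \<epsilon>: "\<epsilon> > 0" "\<bar>t\<bar> ^ 3 * \<epsilon> < r" using r by (simp_all add: \<epsilon>_def field_simps)
  have "(\<lambda>n. t\<^sup>2 * (1 / (sum_sd n)\<^sup>2 * (\<Sum>k=1..n. lindeberg_term \<epsilon> n k))) \<longlonglongrightarrow> 0"
    using assms \<epsilon>(1) unfolding lindeberg_def by (intro tendsto_mult_right_zero) auto
  then have "\<forall>\<^sub>F n in sequentially. t\<^sup>2 * (1 / (sum_sd n)\<^sup>2 * (\<Sum>k=1..n. lindeberg_term \<epsilon> n k)) < r / 2"
    using r by (intro order_tendstoD(2)[of _ 0]) auto
  then have "\<forall>\<^sub>F n in sequentially.
      norm ((\<Sum>k=1..n. char (distr M borel (X k)) (t / sum_sd n) - 1) - of_real (- t\<^sup>2 / 2)) < r"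
    using eventually_ge_at_top[of 1]
  proof eventually_elim
    case (elim n)
    define b where "b = sum_sd n"
    have b: "b > 0" using elim by (simp add: sum_sd_pos b_def)
    let ?z = "\<lambda>k. char (distr M borel (X k)) (t / b)"
    have "t\<^sup>2 / 2 = (\<Sum>k=1..n. (t / b)\<^sup>2 * second_moment k / 2)"
      using b by (simp add: sum_divide_distrib[symmetric] sum_distrib_left[symmetric] sum_sd_square[symmetric] b_def power_divide del: One_nat_def)
    then have "(\<Sum>k=1..n. ?z k - 1) - of_real (- t\<^sup>2 / 2) = (\<Sum>k=1..n. ?z k - 1) + of_real (\<Sum>k=1..n. (t / b)\<^sup>2 * second_moment k / 2)"
      by simp
    also have "\<dots> = (\<Sum>k=1..n. ?z k - (1 - (t / b)\<^sup>2 * second_moment k / 2))"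
      by (simp add: sum.distrib[symmetric] algebra_simps)
    finally have "norm ((\<Sum>k=1..n. ?z k - 1) - of_real (- t\<^sup>2 / 2))
        = norm (\<Sum>k=1..n. ?z k - (1 - (t / b)\<^sup>2 * second_moment k / 2))"
      by (rule arg_cong)
    also have "\<dots> \<le> (\<Sum>k=1..n. t\<^sup>2 / b\<^sup>2 * lindeberg_term \<epsilon> n k + \<bar>t\<bar> ^ 3 * \<epsilon> / 6 * (second_moment k / b\<^sup>2))"
    proof (rule sum_norm_le)
      fix k assume "k \<in> {1..n}"
      then have k: "k \<ge> 1" by simp
      have "expectation (\<lambda>\<omega>. min (6 * (X k \<omega>)\<^sup>2) (\<bar>t / b\<bar> * \<bar>X k \<omega>\<bar> ^ 3))
          \<le> expectation (\<lambda>\<omega>. 6 * ((X k \<omega>)\<^sup>2 * indicator {\<omega> \<in> space M. \<bar>X k \<omega>\<bar> > \<epsilon> * sum_sd n} \<omega>) + \<bar>t\<bar> * \<epsilon> * (X k \<omega>)\<^sup>2)"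
      proof (rule integral_mono)
        fix \<omega> assume \<omega>: "\<omega> \<in> space M"
        show "min (6 * (X k \<omega>)\<^sup>2) (\<bar>t / b\<bar> * \<bar>X k \<omega>\<bar> ^ 3)
           \<le> 6 * ((X k \<omega>)\<^sup>2 * indicator {\<omega> \<in> space M. \<bar>X k \<omega>\<bar> > \<epsilon> * sum_sd n} \<omega>) + \<bar>t\<bar> * \<epsilon> * (X k \<omega>)\<^sup>2"
        proof (cases "\<bar>X k \<omega>\<bar> > \<epsilon> * sum_sd n")
          case True
          then show ?thesis using \<omega> \<epsilon> by (intro min.coboundedI1) auto
        next
          case False
          then have "\<bar>t / b\<bar> * (\<bar>X k \<omega>\<bar> * (X k \<omega>)\<^sup>2) \<le> \<bar>t / b\<bar> * ((\<epsilon> * b) * (X k \<omega>)\<^sup>2)"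
            by (intro mult_left_mono mult_right_mono) (auto simp: b_def)
          also have "\<dots> = \<bar>t\<bar> * \<epsilon> * (X k \<omega>)\<^sup>2" using b by simp
          finally have "\<bar>t / b\<bar> * \<bar>X k \<omega>\<bar> ^ 3 \<le> \<bar>t\<bar> * \<epsilon> * (X k \<omega>)\<^sup>2"
            by (simp add: power3_eq_cube power2_eq_square)
          with False show ?thesis by (intro min.coboundedI2) auto
        qed
      qed (use integrable_min_remainder[OF k, of "t / b"] integrable_lindeberg_term[OF k] square_integrable[OF k] in auto)
      also have "\<dots> = 6 * lindeberg_term \<epsilon> n k + \<bar>t\<bar> * \<epsilon> * second_moment k"
        using integrable_lindeberg_term[OF k] square_integrable[OF k] by (simp add: lindeberg_term_def second_moment_def)
      finally have "(t / b)\<^sup>2 / 6 * expectation (\<lambda>\<omega>. min (6 * (X k \<omega>)\<^sup>2) (\<bar>t / b\<bar> * \<bar>X k \<omega>\<bar> ^ 3))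
          \<le> (t / b)\<^sup>2 / 6 * (6 * lindeberg_term \<epsilon> n k + \<bar>t\<bar> * \<epsilon> * second_moment k)"
        by (intro mult_left_mono) auto
      also have "\<dots> = t\<^sup>2 / b\<^sup>2 * lindeberg_term \<epsilon> n k + \<bar>t\<bar> ^ 3 * \<epsilon> / 6 * (second_moment k / b\<^sup>2)"
      proof -
        have "t\<^sup>2 * \<bar>t\<bar> = \<bar>t\<bar> ^ 3" by (simp add: power3_eq_cube power2_eq_square)
        then show ?thesis
          by (simp add: power_divide distrib_left mult.assoc[symmetric])
      qed
      finally show "norm (?z k - (1 - (t / b)\<^sup>2 * second_moment k / 2)) \<le>
          t\<^sup>2 / b\<^sup>2 * lindeberg_term \<epsilon> n k + \<bar>t\<bar> ^ 3 * \<epsilon> / 6 * (second_moment k / b\<^sup>2)"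
        by (rule order_trans[OF char_second_order[OF k]])
    qed
    also have "\<dots> = t\<^sup>2 * (1 / (sum_sd n)\<^sup>2 * (\<Sum>k=1..n. lindeberg_term \<epsilon> n k)) + \<bar>t\<bar> ^ 3 * \<epsilon> / 6"
      using b unfolding sum.distrib sum_distrib_left[symmetric] sum_divide_distrib[symmetric] sum_sd_square[symmetric] b_def by simp
    also have "\<dots> < r" using elim \<epsilon> r by linarith
    finally show ?case by (simp add: b_def)
  qed
  then show "\<exists>no. \<forall>n\<ge>no. norm ((\<Sum>k=1..n. char (distr M borel (X k)) (t / sum_sd n) - 1) - of_real (- t\<^sup>2 / 2)) < r"
    by (simp only: eventually_sequentially)
qed

theorem lindeberg_imp_weak_convergence:
  assumes lindeberg
  shows "weak_conv_m (\<lambda>n. distr M borel (normalized_sum n)) std_normal_distribution"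
proof (rule levy_continuity)
  show "real_distribution (distr M borel (normalized_sum n))" for n
    by (intro real_distribution_distr) measurable
  show "real_distribution std_normal_distribution" by (rule real_dist_normal_dist)
  fix t
  have "(\<lambda>n. (char (distr M borel (normalized_sum n)) t
      - exp (\<Sum>k=1..n. char (distr M borel (X k)) (t / sum_sd n) - 1))
      + exp (\<Sum>k=1..n. char (distr M borel (X k)) (t / sum_sd n) - 1)) \<longlonglongrightarrow> 0 + exp (of_real (- t\<^sup>2 / 2))"
    by (intro tendsto_add tendsto_exp char_normalized_sum_approx_exp lindeberg_imp_feller_levy
        lindeberg_imp_sum_char_limit assms)
  then show "(\<lambda>n. char (distr M borel (normalized_sum n)) t) \<longlonglongrightarrow> char std_normal_distribution t"
    by (simp only: char_std_normal_distribution exp_of_real diff_add_cancel add_0)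
qed

text \<open>Taking absolute values of \<open>exp (\<Sum>(\<phi>\<^sub>k - 1))\<close> isolates the real part of the exponent, so no branch of
  the complex logarithm is involved. The real part of \<open>\<phi>\<^sub>k - 1\<close> plus the quadratic term is the
  expectation of a nonnegative function that dominates the truncated square.\<close>
theorem char_limit_feller_levy_imp_lindeberg:
  assumes fl: feller_levy
    and ch: "\<And>t. (\<lambda>n. char (distr M borel (normalized_sum n)) t) \<longlonglongrightarrow> of_real (exp (- t\<^sup>2 / 2))"
  shows lindeberg
  unfolding lindeberg_def
proof (intro allI impI)
  fix \<epsilon> :: real assume \<epsilon>: "0 < \<epsilon>"
  define t where "t = sqrt (4 / \<epsilon>\<^sup>2 + 2)"
  have t: "t\<^sup>2 = 4 / \<epsilon>\<^sup>2 + 2" unfolding t_def by (intro real_sqrt_pow2) simp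
  define Z where "Z n = (\<Sum>k=1..n. char (distr M borel (X k)) (t / sum_sd n) - 1)" for n
  have "(\<lambda>n. char (distr M borel (normalized_sum n)) t
      - (char (distr M borel (normalized_sum n)) t - exp (Z n))) \<longlonglongrightarrow> of_real (exp (- t\<^sup>2 / 2)) - 0"
    unfolding Z_def by (intro tendsto_diff ch char_normalized_sum_approx_exp fl)
  then have "(\<lambda>n. norm (exp (Z n))) \<longlonglongrightarrow> norm (complex_of_real (exp (- t\<^sup>2 / 2)))"
    by (intro tendsto_norm) simp
  then have "(\<lambda>n. exp (Re (Z n))) \<longlonglongrightarrow> exp (- t\<^sup>2 / 2)"
    by simp
  then have "(\<lambda>n. ln (exp (Re (Z n)))) \<longlonglongrightarrow> ln (exp (- t\<^sup>2 / 2))"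
    by (intro tendsto_ln) auto
  then have "(\<lambda>n. Re (Z n) + t\<^sup>2 / 2) \<longlonglongrightarrow> - t\<^sup>2 / 2 + t\<^sup>2 / 2"
    by (intro tendsto_add) auto
  then have lim: "(\<lambda>n. Re (Z n) + t\<^sup>2 / 2) \<longlonglongrightarrow> 0" by simp
  show "(\<lambda>n. 1 / (sum_sd n)\<^sup>2 * (\<Sum>k=1..n. lindeberg_term \<epsilon> n k)) \<longlonglongrightarrow> 0"
  proof (rule Lim_null_comparison[OF _ lim])
    show "\<forall>\<^sub>F n in sequentially. norm (1 / (sum_sd n)\<^sup>2 * (\<Sum>k=1..n. lindeberg_term \<epsilon> n k)) \<le> Re (Z n) + t\<^sup>2 / 2"
      using eventually_ge_at_top[of 1]
    proof eventually_elim
      case (elim n)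
      define b where "b = sum_sd n"
      have b: "b > 0" using elim by (simp add: sum_sd_pos b_def)
      have step: "lindeberg_term \<epsilon> n k / b\<^sup>2
          \<le> Re (char (distr M borel (X k)) (t / b) - 1) + t\<^sup>2 / 2 * (second_moment k / b\<^sup>2)"
        if "k \<in> {1..n}" for k
      proof -
        have k: "k \<ge> 1" using that by simp
        note [measurable] = rv[OF k]
        have ic: "integrable M (\<lambda>\<omega>. cos (t / b * X k \<omega>))"
          by (rule integrable_const_bound[where B = 1]) auto
        have ie: "integrable M (\<lambda>\<omega>. iexp (t / b * X k \<omega>))"
          by (rule integrable_const_bound[where B = 1]) auto
        have "lindeberg_term \<epsilon> n k / b\<^sup>2
            = expectation (\<lambda>\<omega>. (X k \<omega>)\<^sup>2 * indicator {\<omega> \<in> space M. \<bar>X k \<omega>\<bar> > \<epsilon> * sum_sd n} \<omega> / b\<^sup>2)"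
          unfolding lindeberg_term_def by simp
        also have "\<dots> \<le> expectation (\<lambda>\<omega>. cos (t / b * X k \<omega>) - 1 + t\<^sup>2 / (2 * b\<^sup>2) * (X k \<omega>)\<^sup>2)"
        proof (rule integral_mono)
          fix \<omega> assume \<omega>: "\<omega> \<in> space M"
          have eq: "cos (t / b * X k \<omega>) - 1 + t\<^sup>2 / (2 * b\<^sup>2) * (X k \<omega>)\<^sup>2
              = cos (t * (X k \<omega> / b)) - 1 + (t * (X k \<omega> / b))\<^sup>2 / 2"
            by (simp add: power_divide power_mult_distrib)
          show "(X k \<omega>)\<^sup>2 * indicator {\<omega> \<in> space M. \<bar>X k \<omega>\<bar> > \<epsilon> * sum_sd n} \<omega> / b\<^sup>2
              \<le> cos (t / b * X k \<omega>) - 1 + t\<^sup>2 / (2 * b\<^sup>2) * (X k \<omega>)\<^sup>2"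
          proof (cases "\<bar>X k \<omega>\<bar> > \<epsilon> * sum_sd n")
            case True
            then have "\<epsilon> < \<bar>X k \<omega> / b\<bar>" using b by (simp add: b_def field_simps)
            from cos_remainder_ge_square[OF \<epsilon> this t] True \<omega> show ?thesis
              unfolding eq by (simp add: power_divide)
          next
            case False
            with cos_ge_quadratic[of "t * (X k \<omega> / b)"] show ?thesis unfolding eq by simp
          qed
        qed (use integrable_lindeberg_term[OF k] square_integrable[OF k] ic in auto)
        also have "\<dots> = expectation (\<lambda>\<omega>. cos (t / b * X k \<omega>)) - 1 + t\<^sup>2 / (2 * b\<^sup>2) * second_moment k"
          using ic square_integrable[OF k] by (simp add: second_moment_def prob_space)
        also have "expectation (\<lambda>\<omega>. cos (t / b * X k \<omega>)) = Re (char (distr M borel (X k)) (t / b))"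
        proof -
          have "char (distr M borel (X k)) (t / b) = (CLINT \<omega>|M. iexp (t / b * X k \<omega>))"
            unfolding char_def by (rule integral_distr) measurable
          then show ?thesis
            using integral_Re[OF ie] by (simp add: Re_exp)
        qed
        finally show ?thesis by simp
      qed
      have l0: "0 \<le> lindeberg_term \<epsilon> n k" for k
        unfolding lindeberg_term_def by (intro integral_nonneg_AE) auto
      have "1 / b\<^sup>2 * (\<Sum>k=1..n. lindeberg_term \<epsilon> n k) = (\<Sum>k=1..n. lindeberg_term \<epsilon> n k / b\<^sup>2)"
        by (simp add: sum_divide_distrib)
      also have "\<dots> \<le> (\<Sum>k=1..n. Re (char (distr M borel (X k)) (t / b) - 1) + t\<^sup>2 / 2 * (second_moment k / b\<^sup>2))"
        by (intro sum_mono step)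
      also have "\<dots> = Re (Z n) + t\<^sup>2 / 2"
        using b unfolding sum.distrib sum_distrib_left[symmetric] sum_divide_distrib[symmetric] sum_sd_square[symmetric]
          b_def Z_def Re_sum by simp
      finally show ?case using l0 by (simp add: b_def sum_nonneg abs_mult)
    qed
  qed
qed

end

section \<open>Convergence in total variation\<close>

lemma RN_derivative_of_std_normal_density:
  "RN_derivative_of std_normal_density (\<lambda>x. - x * std_normal_density x)"
  unfolding RN_derivative_of_def
proof (intro conjI allI impI)
  show "(\<lambda>x. - x * std_normal_density x) \<in> borel_measurable borel" by measurable
  fix a b :: real assume ab: "a \<le> b"
  have D: "(std_normal_density has_real_derivative - x * std_normal_density x) (at x)" for x
    unfolding std_normal_density_def by (auto intro!: derivative_eq_intros simp: field_simps)
  have c: "continuous_on UNIV (\<lambda>x. - x * std_normal_density x)"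
    unfolding std_normal_density_def by (intro continuous_intros) auto
  have i: "integrable lborel (\<lambda>x. - x * std_normal_density x)"
    using integrable_std_normal_moment[of 1] by (simp add: mult.commute)
  then show I: "set_integrable lborel {a<..b} (\<lambda>x. - x * std_normal_density x)"
    unfolding set_integrable_def
    using integrable_real_mult_indicator[of "{a<..b}", OF _ i] by (simp add: mult.commute)
  have "(LINT x:{a<..b}|lborel. - x * std_normal_density x)
      = (LINT x|lborel. indicator {a..b} x *\<^sub>R (- x * std_normal_density x))"
    unfolding set_lebesgue_integral_def using AE_lborel_singleton[of a]
    by (intro integral_cong_AE) (auto split: split_indicator)
  also have "\<dots> = std_normal_density b - std_normal_density a"
    using integral_FTC_atLeastAtMost[OF ab, of std_normal_density "\<lambda>x. - x * std_normal_density x"]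
      D continuous_on_subset[OF c] DERIV_subset[OF D]
    by (simp add: has_real_derivative_iff_has_vector_derivative[symmetric])
  finally show "std_normal_density b - std_normal_density a = (LINT x:{a<..b}|lborel. - x * std_normal_density x)" ..
qed

text \<open>The quotient is kept unreduced (it equals \<open>- x\<close>) so that the limit law is an instance
  of \<open>weak_score_quotient\<close> like the summands.\<close>
lemma (in prob_space) weak_score_std_normal:
  assumes d: "distributed M lborel N (\<lambda>x. ennreal (std_normal_density x))"
  shows "weak_score N (\<lambda>x. - x * std_normal_density x / std_normal_density x)"
proof (rule weak_score_quotient[OF d _ RN_derivative_of_std_normal_density])
  have "(\<integral>\<^sup>+\<omega>. ennreal ((- N \<omega> * std_normal_density (N \<omega>) / std_normal_density (N \<omega>))\<^sup>2) \<partial>M)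
      = (\<integral>\<^sup>+\<omega>. ennreal ((N \<omega>)\<^sup>2) \<partial>M)"
    by (intro nn_integral_cong) (simp add: less_imp_neq[OF normal_density_pos, symmetric])
  also have "\<dots> = (\<integral>\<^sup>+x. ennreal (std_normal_density x) * ennreal (x\<^sup>2) \<partial>lborel)"
    by (rule distributed_nn_integral[OF d, symmetric]) measurable
  also have "\<dots> = (\<integral>\<^sup>+x. ennreal (std_normal_density x * x\<^sup>2) \<partial>lborel)"
    by (simp add: ennreal_mult)
  also have "\<dots> = ennreal (LINT x|lborel. std_normal_density x * x\<^sup>2)"
    by (rule nn_integral_eq_integral[OF integrable_std_normal_moment]) simp
  finally show "(\<integral>\<^sup>+\<omega>. ennreal ((- N \<omega> * std_normal_density (N \<omega>) / std_normal_density (N \<omega>))\<^sup>2) \<partial>M) < \<infinity>"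
    by simp
qed simp

lemma (in prob_space) fisher_J_finite_imp_weak_score:
  assumes dens: "has_abs_continuous_density M X p p'" and J: "fisher_J M X p p' \<le> ennreal C"
    and C: "0 \<le> C" and var: "0 < variance X"
  shows "weak_score X (\<lambda>x. p' x / p x)"
    and "variance X * expectation (\<lambda>\<omega>. (p' (X \<omega>) / p (X \<omega>))\<^sup>2) \<le> C"
proof -
  let ?I = "\<integral>\<^sup>+\<omega>. ennreal ((p' (X \<omega>) / p (X \<omega>))\<^sup>2) \<partial>M"
  have JI: "ennreal (variance X) * ?I \<le> ennreal C"
    using J fisher_J_eq_score[OF dens] by simp
  have fin: "?I < \<infinity>"
  proof (rule ccontr)
    assume "\<not> ?I < \<infinity>"
    then have "?I = \<infinity>" by (simp add: less_top[symmetric])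
    then have "ennreal (variance X) * ?I = \<infinity>" using var by (simp add: ennreal_mult_top)
    with JI show False by (simp add: top_unique)
  qed
  show ws: "weak_score X (\<lambda>x. p' x / p x)"
    using dens fin by (intro weak_score_quotient) (auto simp: has_abs_continuous_density_def)
  have "integrable M (\<lambda>\<omega>. (p' (X \<omega>) / p (X \<omega>))\<^sup>2)" using ws by (simp add: weak_score_def)
  then have "?I = ennreal (expectation (\<lambda>\<omega>. (p' (X \<omega>) / p (X \<omega>))\<^sup>2))"
    by (rule nn_integral_eq_integral) simp
  with JI have "ennreal (variance X * expectation (\<lambda>\<omega>. (p' (X \<omega>) / p (X \<omega>))\<^sup>2)) \<le> ennreal C"
    using var by (simp add: ennreal_mult)
  then show "variance X * expectation (\<lambda>\<omega>. (p' (X \<omega>) / p (X \<omega>))\<^sup>2) \<le> C"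
    using C by (simp add: ennreal_le_iff)
qed

context centered_indep_sequence
begin

text \<open>With weights \<open>a k = \<sigma>\<^sub>k\<^sup>2 / b\<^sup>2\<close> the bound \<open>\<sigma>\<^sub>k\<^sup>2 * E (\<rho>\<^sub>k (X\<^sub>k))\<^sup>2 \<le> C\<close> gives
  \<open>\<Sum>(a k)\<^sup>2 * E (\<rho>\<^sub>k (X\<^sub>k))\<^sup>2 \<le> C / b\<^sup>2\<close>; the factor \<open>1 / b\<close> of its root cancels the factor \<open>b\<close> by which
  the translation of the unnormalized sum is longer. The bound is therefore free of \<open>n\<close>.\<close>
lemma normalized_sum_translation_bound:
  assumes score: "\<And>k. k \<ge> 1 \<Longrightarrow> weak_score (X k) (\<rho> k)"
    and J: "\<And>k. k \<ge> 1 \<Longrightarrow> second_moment k * expectation (\<lambda>\<omega>. (\<rho> k (X k \<omega>))\<^sup>2) \<le> C"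
    and n: "n \<ge> 1" and [measurable]: "h \<in> borel_measurable borel" and h1: "\<And>x. \<bar>h x\<bar> \<le> 1" and t: "0 \<le> t"
  shows "\<bar>expectation (\<lambda>\<omega>. h (normalized_sum n \<omega> + t)) - expectation (\<lambda>\<omega>. h (normalized_sum n \<omega>))\<bar> \<le> sqrt C * t"
proof -
  define b where "b = sum_sd n"
  have b: "b > 0" using sum_sd_pos[OF n] by (simp add: b_def)
  define a where "a k = second_moment k / b\<^sup>2" for k
  let ?I = "\<lambda>k. expectation (\<lambda>\<omega>. (\<rho> k (X k \<omega>))\<^sup>2)"
  have suma: "(\<Sum>k=1..n. a k) = 1"
    using b unfolding a_def sum_divide_distrib[symmetric] sum_sd_square[symmetric] b_def by simp
  have "(\<Sum>k=1..n. (a k)\<^sup>2 * ?I k) \<le> (\<Sum>k=1..n. a k * (C / b\<^sup>2))"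
  proof (rule sum_mono)
    fix k assume "k \<in> {1..n}"
    then have k: "k \<ge> 1" by simp
    have "a k * (second_moment k * ?I k / b\<^sup>2) \<le> a k * (C / b\<^sup>2)"
      using second_moment_pos'[OF k] J[OF k] by (intro mult_left_mono divide_right_mono) (auto simp: a_def)
    then show "(a k)\<^sup>2 * ?I k \<le> a k * (C / b\<^sup>2)" by (simp add: a_def power2_eq_square)
  qed
  also have "\<dots> = C / b\<^sup>2" by (simp only: sum_distrib_right[symmetric] suma)
  finally have I: "sqrt (\<Sum>k=1..n. (a k)\<^sup>2 * ?I k) \<le> sqrt C / b"
    using b real_sqrt_le_mono by (fastforce simp: real_sqrt_divide)
  have "\<bar>expectation (\<lambda>\<omega>. h (((\<Sum>k=1..n. X k \<omega>) + b * t) / b)) - expectation (\<lambda>\<omega>. h ((\<Sum>k=1..n. X k \<omega>) / b))\<bar>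
      \<le> b * t * sqrt (\<Sum>k=1..n. (a k)\<^sup>2 * ?I k)"
    by (rule translation_bound_indep_sum[where h = "\<lambda>x. h (x / b)" and \<rho> = \<rho>])
      (use indep_vars_subset[OF indep] score suma h1 b t in auto)
  also have "\<dots> \<le> b * t * (sqrt C / b)" using I b t by (intro mult_left_mono) auto
  also have "\<dots> = sqrt C * t" using b by simp
  finally show ?thesis using b by (simp add: normalized_sum_def b_def add_divide_distrib)
qed

text \<open>The limit law needs a translation bound too; any finite constant will do, and the first
  absolute moment of its score is one.\<close>
theorem lindeberg_imp_d_TV_convergence:
  fixes M' :: "'b measure"
  assumes lindeberg
    and score: "\<And>k. k \<ge> 1 \<Longrightarrow> weak_score (X k) (\<rho> k)"
    and J: "\<And>k. k \<ge> 1 \<Longrightarrow> second_moment k * expectation (\<lambda>\<omega>. (\<rho> k (X k \<omega>))\<^sup>2) \<le> C"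
    and "prob_space M'" and N: "distributed M' lborel N (\<lambda>x. ennreal (std_normal_density x))"
  shows "(\<lambda>n. d_TV M (normalized_sum n) M' N) \<longlonglongrightarrow> 0"
proof (rule LIMSEQ_I)
  interpret M': prob_space M' by fact
  fix \<epsilon> :: real assume \<epsilon>: "0 < \<epsilon>"
  have [measurable]: "N \<in> borel_measurable M'" using distributed_measurable[OF N] by simp
  have dN: "distr M' borel N = std_normal_distribution"
    using N by (simp add: distributed_def cong: distr_cong)
  let ?\<mu> = "\<lambda>n. distr M borel (normalized_sum n)"
  define K\<^sub>N where "K\<^sub>N = M'.expectation (\<lambda>\<omega>. \<bar>- N \<omega> * std_normal_density (N \<omega>) / std_normal_density (N \<omega>)\<bar>)"
  define K where "K = max (sqrt C) K\<^sub>N"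
  have "\<forall>\<^sub>F n in sequentially. \<forall>h. h \<in> borel_measurable borel \<longrightarrow> (\<forall>x. \<bar>h x\<bar> \<le> 1) \<longrightarrow>
      \<bar>(LINT x|?\<mu> n. h x) - (LINT x|std_normal_distribution. h x)\<bar> < \<epsilon>"
  proof (rule weak_conv_imp_uniform_conv_bounded_measurable[where start = 1 and K = K])
    show "real_distribution (?\<mu> n)" for n by (intro real_distribution_distr) measurable
    show "real_distribution std_normal_distribution" by (rule real_dist_normal_dist)
    show "weak_conv_m ?\<mu> std_normal_distribution" by (rule lindeberg_imp_weak_convergence) fact
    show "\<bar>(LINT x|?\<mu> n. h (x + t)) - (LINT x|?\<mu> n. h x)\<bar> \<le> K * \<bar>t\<bar>"
      if n: "n \<ge> 1" and h: "h \<in> borel_measurable borel" "\<And>x. \<bar>h x\<bar> \<le> 1" for n h t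
    proof (rule translation_bound_signed[OF _ h])
      fix g :: "real \<Rightarrow> real" and s :: real
      assume [measurable]: "g \<in> borel_measurable borel" and g1: "\<And>x. \<bar>g x\<bar> \<le> 1" and s: "0 \<le> s"
      have "\<bar>expectation (\<lambda>\<omega>. g (normalized_sum n \<omega> + s)) - expectation (\<lambda>\<omega>. g (normalized_sum n \<omega>))\<bar> \<le> sqrt C * s"
        by (rule normalized_sum_translation_bound[OF score J n _ g1 s]) auto
      also have "\<dots> \<le> K * s" using s by (intro mult_right_mono) (auto simp: K_def)
      finally show "\<bar>(LINT x|?\<mu> n. g (x + s)) - (LINT x|?\<mu> n. g x)\<bar> \<le> K * s"
        by (simp add: integral_distr)
    qed
    show "\<bar>(LINT x|std_normal_distribution. h (x + t)) - (LINT x|std_normal_distribution. h x)\<bar> \<le> K * \<bar>t\<bar>"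
      if h: "h \<in> borel_measurable borel" "\<And>x. \<bar>h x\<bar> \<le> 1" for h t
    proof (rule translation_bound_signed[OF _ h])
      fix g :: "real \<Rightarrow> real" and s :: real
      assume [measurable]: "g \<in> borel_measurable borel" and g1: "\<And>x. \<bar>g x\<bar> \<le> 1" and s: "0 \<le> s"
      have "\<bar>M'.expectation (\<lambda>\<omega>. g (N \<omega> + s)) - M'.expectation (\<lambda>\<omega>. g (N \<omega>))\<bar> \<le> K\<^sub>N * s"
        unfolding K\<^sub>N_def by (rule M'.weak_score_translation_bound[OF M'.weak_score_std_normal[OF N] _ g1 s]) auto
      also have "\<dots> \<le> K * s" using s by (intro mult_right_mono) (auto simp: K_def)
      finally show "\<bar>(LINT x|std_normal_distribution. g (x + s)) - (LINT x|std_normal_distribution. g x)\<bar> \<le> K * s"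
        unfolding dN[symmetric] by (simp add: integral_distr)
    qed
  qed fact
  then have "\<forall>\<^sub>F n in sequentially. norm (d_TV M (normalized_sum n) M' N - 0) < \<epsilon>"
  proof eventually_elim
    case (elim n)
    have "d_TV M (normalized_sum n) M' N \<le> \<epsilon> / 2"
    proof (rule d_TV_le)
      fix h :: "real \<Rightarrow> real" assume [measurable]: "h \<in> borel_measurable borel" and h1: "\<And>x. \<bar>h x\<bar> \<le> 1"
      have "\<bar>(LINT x|?\<mu> n. h x) - (LINT x|distr M' borel N. h x)\<bar> < \<epsilon>"
        unfolding dN using elim h1 by simp
      then show "\<bar>expectation (\<lambda>\<omega>. h (normalized_sum n \<omega>)) - M'.expectation (\<lambda>\<omega>. h (N \<omega>))\<bar> \<le> \<epsilon>"
        by (simp add: integral_distr)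
    qed
    moreover have "0 \<le> d_TV M (normalized_sum n) M' N"
      using d_TV_bound[OF prob_space_axioms \<open>prob_space M'\<close> measurable_normalized_sum[of n] \<open>N \<in> borel_measurable M'\<close>, of "\<lambda>_. 0"] by simp
    ultimately show ?case using \<epsilon> by simp
  qed
  then show "\<exists>no. \<forall>n\<ge>no. norm (d_TV M (normalized_sum n) M' N - 0) < \<epsilon>"
    by (simp only: eventually_sequentially)
qed

theorem d_TV_convergence_imp_lindeberg:
  assumes tv: "(\<lambda>n. d_TV M (normalized_sum n) M' N) \<longlonglongrightarrow> 0" and feller_levy
    and "prob_space M'" and N: "distributed M' lborel N (\<lambda>x. ennreal (std_normal_density x))"
  shows lindeberg
proof (rule char_limit_feller_levy_imp_lindeberg)
  fix t
  have N': "N \<in> borel_measurable M'" using distributed_measurable[OF N] by simp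
  have dN: "distr M' borel N = std_normal_distribution"
    using N by (simp add: distributed_def cong: distr_cong)
  have "(\<lambda>n. char (distr M borel (normalized_sum n)) t - char (distr M' borel N) t) \<longlonglongrightarrow> 0"
  proof (rule Lim_null_comparison)
    show "(\<lambda>n. 4 * d_TV M (normalized_sum n) M' N) \<longlonglongrightarrow> 0"
      using tv by (rule tendsto_mult_right_zero)
  qed (intro always_eventually allI norm_char_diff_le_d_TV prob_space_axioms assms measurable_normalized_sum N')
  then show "(\<lambda>n. char (distr M borel (normalized_sum n)) t) \<longlonglongrightarrow> of_real (exp (- t\<^sup>2 / 2))"
    unfolding dN char_std_normal_distribution by (rule LIM_zero_cancel)
qed fact

end

theorem corollary1p1:
  fixes M :: "'a measure" and M' :: "'b measure"
    and X :: "nat \<Rightarrow> 'a \<Rightarrow> real" and N :: "'b \<Rightarrow> real"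
    and p p' :: "nat \<Rightarrow> real \<Rightarrow> real"
    and \<sigma>2 b :: "nat \<Rightarrow> real" and S :: "nat \<Rightarrow> 'a \<Rightarrow> real"
  defines "\<sigma>2 \<equiv> \<lambda>k. prob_space.expectation M (\<lambda>\<omega>. (X k \<omega>)\<^sup>2)"
    and "b \<equiv> \<lambda>n. sqrt (\<Sum>k=1..n. \<sigma>2 k)"
    and "S \<equiv> \<lambda>n \<omega>. (\<Sum>k=1..n. X k \<omega>) / b n"
  assumes "prob_space M"
    and "prob_space.indep_vars M (\<lambda>_. borel) X {1..}"
    and "\<And>k. k \<ge> 1 \<Longrightarrow> integrable M (\<lambda>\<omega>. (X k \<omega>)\<^sup>2)"
    and "\<And>k. k \<ge> 1 \<Longrightarrow> prob_space.expectation M (X k) = 0"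
    and "\<And>k. k \<ge> 1 \<Longrightarrow> \<sigma>2 k > 0"
    and "\<And>k. k \<ge> 1 \<Longrightarrow> has_abs_continuous_density M (X k) (p k) (p' k)"
    and "\<And>k. k \<ge> 1 \<Longrightarrow> fisher_J M (X k) (p k) (p' k) < \<infinity>"
    and "(SUP k\<in>{1..}. fisher_J M (X k) (p k) (p' k)) < \<infinity>"
    and "prob_space M'"
    and "distributed M' lborel N (\<lambda>x. ennreal (std_normal_density x))"
  shows "(\<forall>\<epsilon>>0. (\<lambda>n. 1 / (b n)\<^sup>2 *
              (\<Sum>k=1..n. prob_space.expectation M
                 (\<lambda>\<omega>. (X k \<omega>)\<^sup>2 * indicator {\<omega> \<in> space M. \<bar>X k \<omega>\<bar> > \<epsilon> * b n} \<omega>)))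
            \<longlonglongrightarrow> 0)
     \<longleftrightarrow>
       (\<lambda>n. d_TV M (S n) M' N) \<longlonglongrightarrow> 0 \<and>
       (\<lambda>n. MAX k\<in>{1..n}. \<sigma>2 k / (b n)\<^sup>2) \<longlonglongrightarrow> 0"
proof -
  interpret centered_indep_sequence M X
    using assms(4-8) unfolding \<sigma>2_def
    by (intro centered_indep_sequence.intro centered_indep_sequence_axioms.intro) auto
  have \<sigma>2_eq: "\<sigma>2 = second_moment" by (simp add: \<sigma>2_def second_moment_def fun_eq_iff)
  have b_eq: "b = sum_sd" by (simp add: b_def \<sigma>2_eq sum_sd_def fun_eq_iff)
  have S_eq: "S = normalized_sum" by (simp add: S_def b_eq normalized_sum_def fun_eq_iff)
  define C where "C = enn2real (SUP k\<in>{1..}. fisher_J M (X k) (p k) (p' k))"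
  have C: "0 \<le> C" "(SUP k\<in>{1..}. fisher_J M (X k) (p k) (p' k)) = ennreal C"
    unfolding C_def using assms(11)
    by (simp_all only: enn2real_nonneg ennreal_enn2real infinity_ennreal_def)
  have J: "fisher_J M (X k) (p k) (p' k) \<le> ennreal C" if "k \<ge> 1" for k
    unfolding C(2)[symmetric] using that by (intro SUP_upper) auto
  have score: "weak_score (X k) (\<lambda>x. p' k x / p k x)"
    "second_moment k * expectation (\<lambda>\<omega>. (p' k (X k \<omega>) / p k (X k \<omega>))\<^sup>2) \<le> C" if k: "k \<ge> 1" for k
    using fisher_J_finite_imp_weak_score[OF assms(9)[OF k] J[OF k] C(1)] second_moment_pos'[OF k]
    unfolding variance_X[OF k] by blast+
  have "lindeberg \<longleftrightarrow> (\<lambda>n. d_TV M (normalized_sum n) M' N) \<longlonglongrightarrow> 0 \<and> feller_levy"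
    using lindeberg_imp_d_TV_convergence[OF _ score assms(12,13)] lindeberg_imp_feller_levy
      d_TV_convergence_imp_lindeberg[OF _ _ assms(12,13)] by blast
  then show ?thesis
    unfolding lindeberg_def feller_levy_def lindeberg_term_def \<sigma>2_eq b_eq S_eq .
qed

end
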